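(* Let $G$ be a connected graph on $n$ vertices which has a triangle-free $2$-connected block not isomorphic to $C_5$, or has at least two blocks isomorphic to $C_5$. Then $\eta(G)\ge 2n$.
   Context: All graphs are finite and simple. $C_k$ is the cycle of length $k$. A block of a graph is a maximal connected subgraph without a cut-vertex of its own; a block is either a $2$-connected subgraph (on at least $3$ vertices), a single edge, or an isolated vertex; single edges and isolated vertices are not $2$-connected. For a connected graph $G=(V,E)$, $d(a,b)$ is the length of a shortest path between $a$ and $b$. The Wiener index is $W(G)=\sum_{\{a,b\}\subseteq V} d(a,b)$ (sum over unordered pairs of vertices). The Szeged index is $\mathrm{Sz}(G)=\sum_{ab\in E} n_{ab}(a)\cdot n_{ab}(b)$, where $n_{ab}(a)$ is the number of vertices strictly closer to $a$ than to $b$, and $n_{ab}(b)$ is the number of vertices strictly closer to $b$ than to $a$. Define $\eta(G)=\mathrm{Sz}(G)-W(G)$. *)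

theory Defs
  imports "Graph_Theory.Graph_Theory"
begin

text \<open>
  Finite simple graphs are the symmetric digraphs of the locale \<^locale>\<open>graph\<close>: an undirected edge
  is a pair of opposite arcs. Note that \<^const>\<open>Digraph_Component.connected\<close> excludes the graph
  without vertices.
\<close>

definition graph_dist :: "('a, 'b) pre_digraph \<Rightarrow> 'a \<Rightarrow> 'a \<Rightarrow> nat" where
  "graph_dist G u v = (LEAST k. \<exists>p. pre_digraph.apath G u p v \<and> length p = k)"

definition edges :: "('a, 'b) pre_digraph \<Rightarrow> 'a set set" where
  "edges G = (\<lambda>e. {tail G e, head G e}) ` arcs G"

text \<open>
  The value of a symmetric function \<open>f\<close> at an unordered pair; only meaningful if
  \<open>f a b = f b a\<close> and the argument has the form \<open>{a, b}\<close>.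
\<close>

definition on_pair :: "('a \<Rightarrow> 'a \<Rightarrow> 'c) \<Rightarrow> 'a set \<Rightarrow> 'c" where
  "on_pair f P = (THE x. \<exists>a b. P = {a, b} \<and> x = f a b)"

lemma on_pair_eq: "on_pair f {a, b} = f a b" if "f a b = f b a"
  unfolding on_pair_def using that by (intro the_equality) (auto simp: doubleton_eq_iff)

definition wiener_index :: "('a, 'b) pre_digraph \<Rightarrow> nat" where
  "wiener_index G = (\<Sum>P | P \<subseteq> verts G \<and> card P = 2. on_pair (graph_dist G) P)"

definition closer_count :: "('a, 'b) pre_digraph \<Rightarrow> 'a \<Rightarrow> 'a \<Rightarrow> nat" where
  "closer_count G a b = card {w \<in> verts G. graph_dist G w a < graph_dist G w b}"

definition szeged_index :: "('a, 'b) pre_digraph \<Rightarrow> nat" where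
  "szeged_index G = (\<Sum>e\<in>edges G. on_pair (\<lambda>a b. closer_count G a b * closer_count G b a) e)"

definition eta :: "('a, 'b) pre_digraph \<Rightarrow> int" where
  "eta G = int (szeged_index G) - int (wiener_index G)"

definition cut_vertex :: "('a, 'b) pre_digraph \<Rightarrow> 'a \<Rightarrow> bool" where
  "cut_vertex G v \<longleftrightarrow> v \<in> verts G \<and>
    (\<exists>u\<in>verts G - {v}. \<exists>w\<in>verts G - {v}.
      u \<rightarrow>\<^sup>*\<^bsub>G\<^esub> w \<and> \<not> u \<rightarrow>\<^sup>*\<^bsub>pre_digraph.del_vert G v\<^esub> w)"

text \<open>
  The conjunct \<open>graph H\<close> is needed because \<^const>\<open>subgraph\<close> also admits subdigraphs that contain
  only one of two opposite arcs.
\<close>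

definition block :: "('a, 'b) pre_digraph \<Rightarrow> ('a, 'b) pre_digraph \<Rightarrow> bool" where
  "block G B \<longleftrightarrow> pre_digraph.max_subgraph G
    (\<lambda>H. graph H \<and> Digraph_Component.connected H \<and> (\<nexists>v. cut_vertex H v)) B"

definition two_connected :: "('a, 'b) pre_digraph \<Rightarrow> bool" where
  "two_connected G \<longleftrightarrow>
    3 \<le> card (verts G) \<and> Digraph_Component.connected G \<and> (\<nexists>v. cut_vertex G v)"

definition triangle_free :: "('a, 'b) pre_digraph \<Rightarrow> bool" where
  "triangle_free G \<longleftrightarrow> (\<nexists>a b c. a \<rightarrow>\<^bsub>G\<^esub> b \<and> b \<rightarrow>\<^bsub>G\<^esub> c \<and> c \<rightarrow>\<^bsub>G\<^esub> a)"

text \<open>The cycle of length \<open>k\<close>, for \<open>k \<ge> 3\<close>.\<close>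

definition cycle_graph :: "nat \<Rightarrow> nat pair_pre_digraph" where
  "cycle_graph k = \<lparr> pverts = {..<k},
    parcs = {(i, j). i < k \<and> j < k \<and> (j = Suc i mod k \<or> i = Suc j mod k)} \<rparr>"

lemma pair_graph_cycle_graph:
  assumes "3 \<le> k"
  shows "pair_graph (cycle_graph k)"
proof
  show "finite (parcs (cycle_graph k))"
    by (rule finite_subset[of _ "{..<k} \<times> {..<k}"]) (auto simp: cycle_graph_def)
  show "fst e \<noteq> snd e" if "e \<in> parcs (cycle_graph k)" for e
    using that assms by (auto simp: cycle_graph_def mod_Suc split: if_splits)
qed (auto simp: cycle_graph_def symmetric_def intro!: symI)

lemma (in graph) graph_dist_commute: "graph_dist G u v = graph_dist G v u"
proof -
  have *: "\<exists>q. apath y q x \<and> length q = length p" if "apath x p y" for x y p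
  proof -
    have "\<exists>q. awalk b q a \<and> awalk_verts b q = rev (awalk_verts a r) \<and> length q = length r"
      if "awalk a r b" for a b r
      using that
    proof (induction r arbitrary: a)
      case Nil
      then show ?case by (intro exI[of _ "[]"]) (auto simp: awalk_Nil_iff)
    next
      case (Cons e r)
      then have e: "e \<in> arcs G" "tail G e = a" and r: "awalk (head G e) r b"
        by (auto simp: awalk_Cons_iff)
      from Cons.IH[OF r] obtain q where q: "awalk b q (head G e)"
        "awalk_verts b q = rev (awalk_verts (head G e) r)" "length q = length r"
        by blast
      from e sym_arcs obtain e' where e': "e' \<in> arcs G" "tail G e' = head G e" "head G e' = a"
        by (metis symmetric_conv)
      then have e'w: "awalk (head G e) [e'] a"
        by (auto simp: awalk_Cons_iff awalk_Nil_iff)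
      have "awalk_verts b (q @ [e']) = awalk_verts b q @ [a]"
        using awalk_verts_append[OF awalk_appendI[OF q(1) e'w]] e' q(1) by simp
      then show ?case
        using q e awalk_appendI[OF q(1) e'w] by (intro exI[of _ "q @ [e']"]) simp
    qed
    with that show ?thesis unfolding apath_def by (metis distinct_rev)
  qed
  have "(\<exists>p. apath u p v \<and> length p = k) \<longleftrightarrow> (\<exists>p. apath v p u \<and> length p = k)" for k
    using * by metis
  then show ?thesis unfolding graph_dist_def by simp
qed

end

theory Submission
  imports Defs
begin

text \<open>
  Counting, for each ordered pair \<open>(x, u)\<close>, the arcs \<open>(a, b)\<close> with \<open>a\<close> closer to \<open>x\<close> and \<open>b\<close> closer to \<open>u\<close>
  turns \<open>2 * eta\<close> into the sum of the excesses of these numbers over \<open>d x u\<close>, which are nonnegative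
  since the arcs of a geodesic are counted. It therefore suffices that for every vertex \<open>x\<close> of the
  whole graph the excesses of the pairs \<open>(x, u)\<close> with \<open>u\<close> in the given block \<open>S\<close> sum up to 4.

  Every vertex \<open>x\<close> sees \<open>S\<close> through a gate \<open>p\<close>, so the levels of \<open>S\<close> with respect to \<open>x\<close> are those with
  respect to \<open>p\<close>. If some vertex of \<open>S\<close> has two parents (neighbours one level closer), then it has
  excess 2, and each of the parents has excess 1. Otherwise the arcs between levels form a tree and
  each edge inside a level contributes excess 1 at both ends. Such an edge \<open>l y\<close> exists since a
  farthest vertex is not a leaf. If it is the only one, then the parents of \<open>l\<close> and \<open>y\<close> have excess 1
  if they are at distance 3; if they have a common parent \<open>c\<close>, then \<open>c\<close> separates \<open>S\<close> unless \<open>c = p\<close>,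
  and in that case \<open>S\<close> is a pentagon. A pentagon still gives 2 for every \<open>x\<close>, which is enough if there
  are two of them.
\<close>

section \<open>Finite graphs given by adjacency and distance, with parents in place of walks\<close>

locale metric_graph =
  fixes V :: "'a set" and adj :: "'a \<Rightarrow> 'a \<Rightarrow> bool" and d :: "'a \<Rightarrow> 'a \<Rightarrow> nat"
  assumes finite_V: "finite V"
    and adj_sym: "adj x y \<Longrightarrow> adj y x"
    and adj_V: "adj x y \<Longrightarrow> x \<in> V"
    and d_adj: "adj x y \<Longrightarrow> d x y = 1"
    and d_eq_0: "\<lbrakk>x \<in> V; y \<in> V\<rbrakk> \<Longrightarrow> d x y = 0 \<longleftrightarrow> x = y"
    and d_sym: "d x y = d y x"
    and d_triangle: "\<lbrakk>x \<in> V; y \<in> V; z \<in> V\<rbrakk> \<Longrightarrow> d x y \<le> d x z + d z y"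
    and d_parent: "\<lbrakk>x \<in> V; y \<in> V; d x y = Suc k\<rbrakk> \<Longrightarrow> \<exists>z. adj z y \<and> d x z = k"
begin

lemma adj_V2: "adj x y \<Longrightarrow> y \<in> V"
  using adj_V adj_sym by blast

lemma adj_commute: "adj x y \<longleftrightarrow> adj y x"
  using adj_sym by blast

lemma adj_neq: "adj x y \<Longrightarrow> x \<noteq> y"
  using d_adj d_eq_0 adj_V by fastforce

lemma adj_if_d_1: "\<lbrakk>x \<in> V; y \<in> V; d x y = 1\<rbrakk> \<Longrightarrow> adj x y"
  using d_parent[of x y 0] d_eq_0 adj_V by (metis One_nat_def)

lemma d_adj_le: "\<lbrakk>x \<in> V; adj a b\<rbrakk> \<Longrightarrow> d x b \<le> d x a + 1"
  using d_triangle[of x b a] d_adj adj_V adj_V2 by metis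

text \<open>Built by appending an arc to a geodesic that ends in a parent of \<open>y\<close>. The
  exact distances to both ends are what makes its arcs opposing later on.\<close>

lemma ex_geodesic:
  assumes "x \<in> V" "y \<in> V"
  shows "\<exists>f. f 0 = x \<and> f (d x y) = y \<and> (\<forall>i<d x y. adj (f i) (f (Suc i))) \<and>
    (\<forall>i\<le>d x y. f i \<in> V \<and> d x (f i) = i \<and> d (f i) y = d x y - i)"
  using assms
proof (induction "d x y" arbitrary: y)
  case 0
  then have "x = y" "d y y = 0"
    using d_eq_0 by metis+
  with 0 show ?case
    by (intro exI[of _ "\<lambda>_. x"]) auto
next
  case (Suc k)
  then obtain z where z: "adj z y" "d x z = k"
    using d_parent by metis
  with Suc.hyps(1)[of z] Suc.prems(1) adj_V obtain f where f: "f 0 = x" "f k = z"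
    "\<And>i. i < k \<Longrightarrow> adj (f i) (f (Suc i))"
    "\<And>i. i \<le> k \<Longrightarrow> f i \<in> V \<and> d x (f i) = i \<and> d (f i) z = k - i"
    by (metis (no_types, lifting))
  have "d (f i) y = Suc k - i" if "i \<le> k" for i
  proof -
    have "d (f i) y \<le> Suc k - i"
      using d_adj_le[OF _ z(1), of "f i"] f(4)[OF that] that by simp
    moreover have "Suc k \<le> i + d (f i) y"
      using d_triangle[of x y "f i"] f(4)[OF that] Suc by simp
    ultimately show ?thesis by simp
  qed
  moreover have "d y y = 0"
    using Suc.prems d_eq_0 by blast
  ultimately show ?case
    using f z Suc.prems unfolding Suc.hyps(2)[symmetric]
    by (intro exI[of _ "f(Suc k := y)"]) (auto simp: le_Suc_eq less_Suc_eq Suc.hyps(2)[symmetric])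
qed

subsection \<open>Excess of a pair of vertices\<close>

definition opposing :: "'a \<Rightarrow> 'a \<Rightarrow> ('a \<times> 'a) set" where
  "opposing x u = {(a, b). adj a b \<and> d x a < d x b \<and> d u b < d u a}"

text \<open>For vertices in \<open>V\<close> the subtraction does not truncate, by
  \<open>d_le_card_opposing\<close>.\<close>

definition excess :: "'a \<Rightarrow> 'a \<Rightarrow> nat" where
  "excess x u = card (opposing x u) - d x u"

lemma finite_opposing: "finite (opposing x u)"
  by (rule finite_subset[of _ "V \<times> V"]) (auto simp: opposing_def adj_V adj_V2 finite_V)

lemma excess_commute: "excess x u = excess u x"
proof -
  have "opposing x u = prod.swap ` opposing u x"
    by (force simp: opposing_def adj_sym)
  then show ?thesis
    unfolding excess_def by (simp add: card_image d_sym)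
qed

text \<open>Arcs with distinct levels with respect to \<open>x\<close> are distinct, so a geodesic need not be tracked as a whole.\<close>

lemma d_plus_card_le_opposing:
  assumes F: "F \<subseteq> opposing x u"
    and level: "\<And>i. i < d x u \<Longrightarrow> \<exists>a b. (a, b) \<in> opposing x u - F \<and> d x a = i"
  shows "d x u + card F \<le> card (opposing x u)"
proof -
  have "\<forall>i\<in>{..<d x u}. \<exists>e. e \<in> opposing x u - F \<and> d x (fst e) = i"
    using level by fastforce
  then obtain g where g: "\<And>i. i < d x u \<Longrightarrow> g i \<in> opposing x u - F \<and> d x (fst (g i)) = i"
    by (metis lessThan_iff)
  have "inj_on g {..<d x u}"
    by (intro inj_onI) (metis g lessThan_iff)
  then have "card (g ` {..<d x u} \<union> F) = d x u + card F"
    using g finite_subset[OF F finite_opposing] by (subst card_Un_disjoint) (auto simp: card_image)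
  moreover have "g ` {..<d x u} \<union> F \<subseteq> opposing x u"
    using g F by auto
  ultimately show ?thesis
    using card_mono[OF finite_opposing] by metis
qed

lemma card_le_excess:
  assumes "F \<subseteq> opposing x u"
    and "\<And>i. i < d x u \<Longrightarrow> \<exists>a b. (a, b) \<in> opposing x u - F \<and> d x a = i"
  shows "card F \<le> excess x u"
  using d_plus_card_le_opposing[OF assms] unfolding excess_def by simp

lemma ex_geodesic_arc:
  assumes "x \<in> V" "u \<in> V" "i < d x u"
  shows "\<exists>a b. (a, b) \<in> opposing x u \<and> d x a = i \<and> d x b = Suc i"
proof -
  obtain f where f: "\<forall>i<d x u. adj (f i) (f (Suc i))"
    "\<forall>i\<le>d x u. f i \<in> V \<and> d x (f i) = i \<and> d (f i) u = d x u - i"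
    using ex_geodesic[OF assms(1,2)] by blast
  then have "(f i, f (Suc i)) \<in> opposing x u"
    using assms(3) unfolding opposing_def by (auto simp: d_sym[of u])
  with f assms(3) show ?thesis
    by (metis Suc_leI less_imp_le)
qed

lemma d_le_card_opposing: "\<lbrakk>x \<in> V; u \<in> V\<rbrakk> \<Longrightarrow> d x u \<le> card (opposing x u)"
  using d_plus_card_le_opposing[of "{}" x u] ex_geodesic_arc
  by (metis Diff_empty add_0_right card.empty empty_subsetI)

text \<open>Besides a geodesic through \<open>a\<close>, the arcs \<open>(b', b)\<close> and
  \<open>(b, u)\<close> are counted, where \<open>b'\<close> is a parent of \<open>b\<close>. It
  exists because \<open>x\<close> is alone on level 0, whereas \<open>a\<close> and \<open>b\<close>
  share a level.\<close>

lemma excess_two_parents: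
  assumes x: "x \<in> V" and u: "adj a u" "adj b u" and ab: "a \<noteq> b"
    and level: "d x u = Suc (d x a)" "d x b = d x a"
  shows "2 \<le> excess x u"
proof -
  note V = adj_V[OF u(1)] adj_V[OF u(2)] adj_V2[OF u(1)]
  have "d x a \<noteq> 0"
    using ab level d_eq_0 x V by metis
  then obtain k where k: "d x a = Suc k"
    using not0_implies_Suc by blast
  obtain a' b' where a': "adj a' a" "d x a' = k" and b': "adj b' b" "d x b' = k"
    using d_parent x V k level(2) by metis
  note V' = adj_V[OF a'(1)] adj_V[OF b'(1)]
  have far: "1 < d u a'" "1 < d u b'"
    using d_triangle[of x u a'] d_triangle[of x u b'] x V V' level k a' b' d_sym by auto
  have "d u a = 1" "d u b = 1" "d u u = 0"
    using u adj_sym d_adj d_eq_0 V by blast+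
  then have opp: "{(a, u), (b, u), (a', a), (b', b)} \<subseteq> opposing x u"
    using u a' b' level k far by (simp add: opposing_def)
  have "card {(b, u), (b', b)} \<le> excess x u"
  proof (rule card_le_excess)
    show "{(b, u), (b', b)} \<subseteq> opposing x u"
      using opp by simp
    \<comment> \<open>The two highest arcs are taken along \<open>a'\<close>, \<open>a\<close>,
      \<open>u\<close>, which avoids the removed ones; geodesic arcs on lower levels avoid them
      anyway.\<close>
    fix i assume i: "i < d x u"
    consider "i = Suc k" | "i = k" | "i < k"
      using i level k by linarith
    then show "\<exists>p q. (p, q) \<in> opposing x u - {(b, u), (b', b)} \<and> d x p = i"
    proof cases
      case 1
      then show ?thesis
        using opp ab k b' a' by (intro exI[of _ a] exI[of _ u]) auto
    next
      case 2
      then show ?thesis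
        using opp ab k b' a' level by (intro exI[of _ a'] exI[of _ a]) auto
    next
      case 3
      obtain p q where "(p, q) \<in> opposing x u" "d x p = i"
        using ex_geodesic_arc[OF x V(3) i] by blast
      with 3 k b' level show ?thesis
        by (intro exI[of _ p] exI[of _ q]) auto
    qed
  qed
  moreover have "u \<noteq> b"
    using adj_neq u by blast
  ultimately show ?thesis by simp
qed

text \<open>The levels below \<open>d x u\<close> are served by geodesic arcs, and
  \<open>(b, c)\<close> starts at level \<open>d x u\<close> or beyond, so it is one arc
  more.\<close>

lemma excess_pos:
  assumes x: "x \<in> V" and u: "u \<in> V" and b: "adj b c" "d x u \<le> d x b" "d x b < d x c" "d u c < d u b"
  shows "1 \<le> excess x u"
proof -
  have "card {(b, c)} \<le> excess x u"
  proof (rule card_le_excess)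
    show "{(b, c)} \<subseteq> opposing x u"
      using b by (simp add: opposing_def)
    show "\<exists>p q. (p, q) \<in> opposing x u - {(b, c)} \<and> d x p = i" if "i < d x u" for i
      using ex_geodesic_arc[OF x u that] that b by fastforce
  qed
  then show ?thesis by simp
qed

text \<open>The extra arc is \<open>(b, u)\<close>: as \<open>a\<close> and \<open>b\<close> are not
  adjacent, \<open>u\<close> is closer to \<open>a\<close> than \<open>b\<close> is.\<close>

lemma excess_sibling:
  assumes x: "x \<in> V" and u: "adj a u" "adj b u" "a \<noteq> b" "\<not> adj a b"
    and level: "d x u = Suc (d x a)" "d x b = d x a"
  shows "1 \<le> excess x a"
proof (rule excess_pos[OF x adj_V[OF u(1)] u(2)])
  have "d a b \<noteq> 0" "d a b \<noteq> 1"
    using u d_eq_0 adj_if_d_1 adj_V by metis+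
  then show "d a u < d a b"
    using d_adj u by simp
qed (use level in auto)

subsection \<open>Sets without separating vertex\<close>

text \<open>Connectivity of the induced subgraph, expressed by cuts instead of paths; the empty set
  and singletons satisfy it.\<close>

definition conn :: "'a set \<Rightarrow> bool" where
  "conn X \<longleftrightarrow> (\<forall>T\<subseteq>X. T \<noteq> {} \<longrightarrow> T \<noteq> X \<longrightarrow> (\<exists>t\<in>T. \<exists>s\<in>X - T. adj t s))"

definition nonsep :: "'a set \<Rightarrow> bool" where
  "nonsep S \<longleftrightarrow> conn S \<and> (\<forall>w. conn (S - {w}))"

text \<open>Blocks are induced subgraphs (see \<open>blockD\<close>), so they can be represented by
  their vertex sets.\<close>

definition block_set :: "'a set \<Rightarrow> bool" where
  "block_set S \<longleftrightarrow> S \<noteq> {} \<and> S \<subseteq> V \<and> nonsep S \<and> (\<forall>T. S \<subseteq> T \<and> T \<subseteq> V \<and> nonsep T \<longrightarrow> T = S)"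

text \<open>A cut of \<open>Y\<close> that splits \<open>X\<close> is crossed inside
  \<open>X\<close>. Otherwise one of its sides avoids \<open>X\<close>, and adjacency is symmetric,
  so only subsets of \<open>Y - X\<close> are left to check.\<close>

lemma connI:
  assumes "conn X" "X \<subseteq> Y"
    and "\<And>T. T \<subseteq> Y - X \<Longrightarrow> T \<noteq> {} \<Longrightarrow> \<exists>t\<in>T. \<exists>s\<in>Y - T. adj t s"
  shows "conn Y"
  unfolding conn_def
proof (intro allI impI)
  fix T assume T: "T \<subseteq> Y" "T \<noteq> {}" "T \<noteq> Y"
  consider "T \<subseteq> Y - X" | "X \<subseteq> T" | "T \<inter> X \<noteq> {}" "T \<inter> X \<noteq> X"
    using T by blast
  then show "\<exists>t\<in>T. \<exists>s\<in>Y - T. adj t s"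
  proof cases
    case 1
    with assms(3) T show ?thesis by blast
  next
    case 2
    then have "Y - T \<subseteq> Y - X" "Y - T \<noteq> {}"
      using T by auto
    from assms(3)[OF this] show ?thesis
      using adj_sym T by blast
  next
    case 3
    then obtain t s where "t \<in> T \<inter> X" "s \<in> X - T \<inter> X" "adj t s"
      using assms(1) unfolding conn_def by (metis inf_le2)
    with assms(2) show ?thesis by blast
  qed
qed

lemma nonsepD: "nonsep S \<Longrightarrow> conn (S - {w})"
  unfolding nonsep_def by blast

text \<open>Otherwise \<open>{l}\<close> would have no edge to the rest of \<open>S - {q}\<close>,
  or of \<open>S\<close> if \<open>q = l\<close>. Applied to a parent \<open>q\<close>, this
  excludes leaves.\<close>

lemma nonsep_neighbour:
  assumes "nonsep S" "3 \<le> card S" "l \<in> S"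
  shows "\<exists>r\<in>S. r \<noteq> q \<and> adj l r"
proof (cases "q = l")
  case True
  have "{l} \<noteq> S"
    using assms by auto
  then show ?thesis
    using True assms adj_neq unfolding nonsep_def conn_def
    by (metis Diff_iff empty_subsetI insert_not_empty insert_subset singletonD)
next
  case False
  have "\<not> S \<subseteq> {l, q}"
    using assms card_mono[of "{l, q}" S] False by auto
  then have "{l} \<noteq> S - {q}"
    by blast
  with False assms nonsepD[of S q] show ?thesis
    unfolding conn_def by (metis Diff_iff empty_subsetI insert_not_empty insert_subset singletonD singletonI)
qed

text \<open>Chords are allowed here; in a triangle-free block there are none, as
  \<open>pentagon_iso\<close> shows.\<close>

definition pentagon :: "'a set \<Rightarrow> bool" where
  "pentagon S \<longleftrightarrow> (\<exists>v0 v1 v2 v3 v4. S = {v0, v1, v2, v3, v4} \<and> distinct [v0, v1, v2, v3, v4] \<and>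
    adj v0 v1 \<and> adj v1 v2 \<and> adj v2 v3 \<and> adj v3 v4 \<and> adj v4 v0)"

text \<open>The path may meet \<open>S\<close> in interior points; only its injectivity matters.\<close>

lemma nonsep_ear:
  assumes S: "nonsep S"
    and f: "inj_on f {..n}" "\<And>i. i < n \<Longrightarrow> adj (f i) (f (Suc i))"
    and ends: "f 0 \<in> S" "f n \<in> S" "0 < n"
  shows "nonsep (S \<union> f ` {..n})"
proof -
  have up: "f k \<in> T" if "i \<le> k" "k \<le> n" "f i \<in> T" "\<forall>j\<in>{i..n}. f j \<in> Y"
    "\<not> (\<exists>t\<in>T. \<exists>s\<in>Y - T. adj t s)" for i k T Y
    using that(1,2)
  proof (induction k rule: dec_induct)
    case base
    show ?case by fact
  next
    case (step k)
    then have "adj (f k) (f (Suc k))" "f k \<in> T" "f (Suc k) \<in> Y"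
      using f(2) that(4) by auto
    then show ?case using that(5) by blast
  qed
  have down: "f k \<in> T" if "k \<le> i" "i \<le> n" "f i \<in> T" "\<forall>j\<le>i. f j \<in> Y"
    "\<not> (\<exists>t\<in>T. \<exists>s\<in>Y - T. adj t s)" for i k T Y
    using that(1)
  proof (induction k rule: inc_induct)
    case base
    show ?case by fact
  next
    case (step k)
    then have "adj (f (Suc k)) (f k)" "f (Suc k) \<in> T" "f k \<in> Y"
      using f(2) that(2,4) adj_sym by auto
    then show ?case using that(5) by blast
  qed
  have *: "conn ((S \<union> f ` {..n}) - W)" if W: "conn (S - W)" "\<exists>w. W \<subseteq> {w}" for W
  proof (rule connI[OF W(1)])
    let ?Y = "(S \<union> f ` {..n}) - W"
    show "S - W \<subseteq> ?Y" by blast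
    fix T assume T: "T \<subseteq> ?Y - (S - W)" "T \<noteq> {}"
    show "\<exists>t\<in>T. \<exists>s\<in>?Y - T. adj t s"
    proof (rule ccontr)
      assume closed: "\<not> ?thesis"
      obtain i where i: "i \<le> n" "f i \<in> T"
        using T by blast
      \<comment> \<open>\<open>W\<close> is empty or a singleton, so by injectivity the path meets
        it at most once. Hence from \<open>f i\<close> one of the two ends is reached without
        meeting \<open>W\<close>; that end lies in \<open>S - W\<close>, which \<open>T\<close>
        avoids.\<close>
      have "(\<forall>j\<in>{i..n}. f j \<notin> W) \<or> (\<forall>j\<le>i. f j \<notin> W)"
      proof (rule ccontr)
        assume "\<not> ?thesis"
        then obtain j k where "j \<le> i" "f j \<in> W" "i \<le> k" "k \<le> n" "f k \<in> W"
          by auto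
        moreover from this have "f j = f k"
          using W(2) by blast
        ultimately have "j = k"
          using f(1) i(1) by (auto dest: inj_onD)
        then have "f i \<in> W"
          using \<open>j \<le> i\<close> \<open>i \<le> k\<close> \<open>f j \<in> W\<close> by simp
        then show False using i T by blast
      qed
      then consider "\<forall>j\<in>{i..n}. f j \<in> ?Y" | "\<forall>j\<le>i. f j \<in> ?Y"
        using i by fastforce
      then show False
      proof cases
        case 1
        then show False
          using up[of i n T ?Y] i closed T ends by blast
      next
        case 2
        then show False
          using down[of 0 i T ?Y] i closed T ends by blast
      qed
    qed
  qed
  show ?thesis
    unfolding nonsep_def using *[of "{}"] *[of "{w}" for w] S unfolding nonsep_def by auto
qed

section \<open>Consequences of maximality: paths, convexity and gates\<close>

lemma block_ear:
  assumes S: "block_set S"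
    and f: "inj_on f {..n}" "\<And>i. i < n \<Longrightarrow> adj (f i) (f (Suc i))"
    and ends: "f 0 \<in> S" "f n \<in> S" and i: "i \<le> n"
  shows "f i \<in> S"
proof (cases "n = 0")
  case False
  have "f ` {..n} \<subseteq> V"
  proof
    fix y assume "y \<in> f ` {..n}"
    then obtain j where "j \<le> n" "y = f j" by blast
    then show "y \<in> V"
      using f(2)[of j] ends(2) S adj_V unfolding block_set_def by (cases "j = n") auto
  qed
  then have "S \<union> f ` {..n} = S"
    using S nonsep_ear[of S f n] f ends False unfolding block_set_def by blast
  then show ?thesis using i by blast
qed (use i ends in auto)

text \<open>As \<open>w\<close> lies between \<open>a\<close> and \<open>b\<close>, geodesics from
  \<open>a\<close> to \<open>w\<close> and from \<open>w\<close> to \<open>b\<close> join to a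
  geodesic. It is injective since the distance from \<open>a\<close> grows along it, so
  \<open>block_ear\<close> applies.\<close>

lemma block_convex:
  assumes S: "block_set S" and ab: "a \<in> S" "b \<in> S" and w: "w \<in> V" "d a w + d w b = d a b"
  shows "w \<in> S"
proof -
  have V: "a \<in> V" "b \<in> V"
    using S ab unfolding block_set_def by auto
  obtain f where f: "f 0 = a" "f (d a w) = w" "\<And>i. i < d a w \<Longrightarrow> adj (f i) (f (Suc i))"
    "\<And>i. i \<le> d a w \<Longrightarrow> f i \<in> V \<and> d a (f i) = i"
    using ex_geodesic[OF V(1) w(1)] by metis
  obtain g where g: "g 0 = w" "g (d w b) = b" "\<And>i. i < d w b \<Longrightarrow> adj (g i) (g (Suc i))"
    "\<And>i. i \<le> d w b \<Longrightarrow> g i \<in> V \<and> d w (g i) = i \<and> d (g i) b = d w b - i"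
    using ex_geodesic[OF w(1) V(2)] by metis
  define h where "h i = (if i \<le> d a w then f i else g (i - d a w))" for i
  have "d a (h i) = i" if "i \<le> d a b" for i
  proof (cases "i \<le> d a w")
    case False
    define j where "j = i - d a w"
    have j: "i = d a w + j" "j \<le> d w b"
      using False that w by (auto simp: j_def)
    have "d a b \<le> d a (g j) + d (g j) b" "d a (g j) \<le> d a w + d w (g j)"
      using d_triangle V w(1) g(4)[OF j(2)] by blast+
    then show ?thesis
      using False g(4)[OF j(2)] j w(2) by (auto simp: h_def)
  qed (use f in \<open>auto simp: h_def\<close>)
  then have "inj_on h {..d a b}"
    by (metis inj_onI atMost_iff)
  moreover have "adj (h i) (h (Suc i))" if "i < d a b" for i
  proof -
    consider "i < d a w" | "i = d a w" | j where "i = d a w + j" "0 < j"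
      by (metis less_imp_add_positive linorder_neqE_nat)
    then show ?thesis
      using that f g(3)[of 0] g(1) g(3)[of "i - d a w"] w(2)
      by cases (auto simp: h_def Suc_diff_le)
  qed
  moreover have "h 0 = a" "h (d a w) = w"
    using f(1,2) by (simp_all add: h_def)
  moreover have "h (d a b) = b"
    using f(2) g(1,2) unfolding h_def w(2)[symmetric] by (cases "d w b = 0") auto
  moreover have "d a w \<le> d a b"
    using w(2) by simp
  ultimately show ?thesis
    using block_ear[OF S, of h "d a b" "d a w"] ab by metis
qed

text \<open>The gate is a vertex \<open>p\<close> of \<open>S\<close> closest to \<open>x\<close>.
  For \<open>y\<close> in \<open>S\<close> let \<open>z\<close> be farthest from \<open>x\<close>
  among the vertices between \<open>x\<close> and \<open>p\<close> that are also between
  \<open>x\<close> and \<open>y\<close>. Geodesics from \<open>z\<close> to \<open>p\<close> and to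
  \<open>y\<close> form a path, so \<open>z\<close> lies in \<open>S\<close>, and the choice of
  \<open>p\<close> gives \<open>z = p\<close>.\<close>

lemma ex_gate:
  assumes S: "block_set S" and x: "x \<in> V"
  shows "\<exists>p\<in>S. \<forall>y\<in>S. d x y = d x p + d p y"
proof -
  have SV: "S \<subseteq> V" "S \<noteq> {}"
    using S unfolding block_set_def by auto
  then obtain p where p: "p \<in> S" "\<And>y. y \<in> S \<Longrightarrow> d x p \<le> d x y"
    using ex_has_least_nat[of "\<lambda>y. y \<in> S" _ "d x"] by blast
  have "d x y = d x p + d p y" if y: "y \<in> S" for y
  proof -
    have V: "p \<in> V" "y \<in> V"
      using p y SV by auto
    let ?I = "{z\<in>V. d x z + d z p = d x p \<and> d x z + d z y = d x y}"
    have "finite ?I" "x \<in> ?I"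
      using finite_V x d_eq_0 by auto
    then have "Max (d x ` ?I) \<in> d x ` ?I" "finite (d x ` ?I)"
      by (blast intro: Max_in)+
    then obtain z where z: "z \<in> ?I" and "Max (d x ` ?I) = d x z"
      by blast
    with \<open>finite (d x ` ?I)\<close> have z_max: "d x w \<le> d x z" if "w \<in> ?I" for w
      using that by (metis (mono_tags, lifting) Max_ge imageI)
    have zV: "z \<in> V" and z_between: "d x z + d z p = d x p" "d x z + d z y = d x y"
      using z by simp_all
    obtain f where f: "f 0 = z" "f (d z p) = p" "\<And>i. i < d z p \<Longrightarrow> adj (f i) (f (Suc i))"
      "\<And>i. i \<le> d z p \<Longrightarrow> f i \<in> V \<and> d z (f i) = i \<and> d (f i) p = d z p - i"
      using ex_geodesic[OF zV V(1)] by metis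
    obtain g where g: "g 0 = z" "g (d z y) = y" "\<And>i. i < d z y \<Longrightarrow> adj (g i) (g (Suc i))"
      "\<And>i. i \<le> d z y \<Longrightarrow> g i \<in> V \<and> d z (g i) = i \<and> d (g i) y = d z y - i"
      using ex_geodesic[OF zV V(2)] by metis
    \<comment> \<open>A common vertex at distance \<open>i\<close> from \<open>z\<close> would
      belong to \<open>?I\<close> and be farther from \<open>x\<close> than \<open>z\<close> by
      \<open>i\<close>.\<close>
    have disj: "i = 0" if ij: "i \<le> d z p" "j \<le> d z y" "f i = g j" for i j
    proof -
      let ?w = "f i"
      have w: "?w \<in> V" "d z ?w = i" "d ?w p = d z p - i" "d ?w y = d z y - i"
        using f(4)[of i] g(4)[of j] ij by auto
      have "i \<le> d z y"
        using f(4)[of i] g(4)[of j] ij by auto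
      have "d x ?w \<le> d x z + i" "d x p \<le> d x ?w + d ?w p" "d x y \<le> d x ?w + d ?w y"
        using d_triangle x w V zV by metis+
      then have "d x ?w = d x z + i"
        using w(3,4) z_between ij(1) \<open>i \<le> d z y\<close> by simp
      moreover from this have "?w \<in> ?I"
        using w z_between ij(1) \<open>i \<le> d z y\<close> by simp
      ultimately show ?thesis
        using z_max[of ?w] by simp
    qed
    define m n where "m = d z p" and "n = d z p + d z y"
    define h where "h i = (if i \<le> m then f (m - i) else g (i - m))" for i
    have "inj_on h {..n}"
    proof (rule inj_onI)
      fix i j assume ij: "i \<in> {..n}" "j \<in> {..n}" "h i = h j"
      have cross: False if "k \<le> m" "m < l" "l \<le> n" "h k = h l" for k l
      proof -
        have "f (m - k) = g (l - m)"
          using that by (simp add: h_def)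
        moreover from this have "m - k = 0"
          using disj[of "m - k" "l - m"] that by (simp add: m_def n_def)
        ultimately have "g (l - m) = z"
          using f(1) by simp
        then show False
          using g(4)[of "l - m"] that d_eq_0[of z z] zV by (auto simp: m_def n_def)
      qed
      show "i = j"
      proof (cases "i \<le> m \<longleftrightarrow> j \<le> m")
        case True
        show ?thesis
        proof (cases "i \<le> m")
          case le: True
          then have "m - i = m - j"
            using True ij(3) f(4)[of "m - i"] f(4)[of "m - j"] by (simp add: h_def m_def)
          then show ?thesis using le True by simp
        next
          case gt: False
          then have "i - m = j - m"
            using True ij g(4)[of "i - m"] g(4)[of "j - m"] by (simp add: h_def m_def n_def)
          then show ?thesis using gt True by simp
        qed
      next
        case False
        then show ?thesis
          using cross[of i j] cross[of j i] ij by force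
      qed
    qed
    moreover have "adj (h i) (h (Suc i))" if "i < n" for i
    proof -
      consider "i < m" | "i = m" | "m < i"
        by linarith
      then show ?thesis
      proof cases
        case 1
        then show ?thesis
          using f(3)[of "m - Suc i"] adj_sym by (simp add: h_def m_def Suc_diff_Suc)
      next
        case 2
        then show ?thesis
          using f(1) g(1) g(3)[of 0] that by (simp add: h_def n_def m_def)
      next
        case 3
        then show ?thesis
          using g(3)[of "i - m"] that by (simp add: h_def n_def m_def Suc_diff_le)
      qed
    qed
    moreover have "h 0 = p" "h m = z" "m \<le> n"
      using f(1,2) by (simp_all add: h_def m_def n_def)
    moreover have "h n = y"
      using f(1) g(1,2) by (cases "d z y = 0") (simp_all add: h_def m_def n_def)
    ultimately have "z \<in> S"
      using block_ear[OF S, of h n m] p y by metis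
    then have "d z p = 0"
      using p(2)[of z] z_between by simp
    then have "z = p"
      using d_eq_0 zV V by blast
    then show ?thesis using z_between by simp
  qed
  then show ?thesis using p by blast
qed

end

subsection \<open>Excess within a triangle-free block\<close>

locale triangle_free_block = metric_graph +
  fixes S :: "'a set" and x p :: 'a
  assumes block: "block_set S"
    and card_S: "3 \<le> card S"
    and no_triangle: "\<lbrakk>a \<in> S; b \<in> S; c \<in> S; adj a b; adj b c\<rbrakk> \<Longrightarrow> \<not> adj c a"
    and x: "x \<in> V"
    and p: "p \<in> S"
    and gate: "y \<in> S \<Longrightarrow> d x y = d x p + d p y"
begin

lemma S_V: "a \<in> S \<Longrightarrow> a \<in> V"
  using block unfolding block_set_def by blast

lemma finite_S: "finite S"
  using finite_subset[OF subsetI finite_V] S_V by blast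

lemma gate_closest: "\<lbrakk>u \<in> S; u \<noteq> p\<rbrakk> \<Longrightarrow> d x p < d x u"
  using gate[of u] d_eq_0[OF S_V[OF p] S_V, of u] by simp

lemma not_gate_if_closer: "\<lbrakk>u \<in> S; a \<in> S; a \<noteq> u; d x a \<le> d x u\<rbrakk> \<Longrightarrow> u \<noteq> p"
  using gate_closest[of a] by (metis not_le)

text \<open>The vertex before \<open>u\<close> on a geodesic from \<open>c\<close> lies in
  \<open>S\<close> by convexity. For \<open>c = p\<close> this gives parents within
  \<open>S\<close>; other \<open>c\<close> occur when \<open>c\<close> is shown to separate
  \<open>S\<close>.\<close>

lemma parent_towards:
  assumes "c \<in> S" "u \<in> S" "u \<noteq> c" "d x u = d x c + d c u"
  shows "\<exists>a\<in>S. adj a u \<and> d x u = Suc (d x a) \<and> d x a = d x c + d c a"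
proof -
  have "d c u \<noteq> 0"
    using assms d_eq_0 S_V by blast
  then obtain k where k: "d c u = Suc k"
    using not0_implies_Suc by blast
  then obtain a where a: "adj a u" "d c a = k"
    using d_parent assms S_V by metis
  have "a \<in> S"
    using block_convex[OF block assms(1,2)] a k d_adj adj_V by simp
  moreover have "d x a \<le> d x c + k" "d x u \<le> d x a + 1"
    using d_triangle[of x a c] d_adj_le[OF x a(1)] a assms S_V x adj_V by auto
  ultimately show ?thesis
    using assms(4) a k by auto
qed

lemma ex_parent: "\<lbrakk>u \<in> S; u \<noteq> p\<rbrakk> \<Longrightarrow> \<exists>a\<in>S. adj a u \<and> d x u = Suc (d x a)"
  using parent_towards[OF p, of u] gate by blast

lemma d_adj_cases:
  assumes "adj a b"
  obtains "d x b = Suc (d x a)" | "d x b = d x a" | "d x a = Suc (d x b)"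
  using d_adj_le[OF x assms] d_adj_le[OF x adj_sym[OF assms]] by linarith

definition siblings :: "'a \<Rightarrow> 'a set" where
  "siblings u = {h \<in> S. adj h u \<and> d x h = d x u}"

text \<open>The gate is left out so that the pairs counted for two blocks stay disjoint in
  \<open>sum_excess_ge_two_blocks\<close>.\<close>

definition total :: nat where
  "total = (\<Sum>u\<in>S - {p}. excess x u)"

lemma sum_le_total: "\<lbrakk>X \<subseteq> S; p \<notin> X\<rbrakk> \<Longrightarrow> (\<Sum>u\<in>X. excess x u) \<le> total"
  unfolding total_def using finite_S by (intro sum_mono2) auto

lemma siblings_sym: "\<lbrakk>u \<in> S; h \<in> siblings u\<rbrakk> \<Longrightarrow> u \<in> siblings h"
  unfolding siblings_def by (auto simp: adj_commute)

lemma siblings_not_gate: "\<lbrakk>u \<in> S; h \<in> siblings u\<rbrakk> \<Longrightarrow> u \<noteq> p"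
  unfolding siblings_def using not_gate_if_closer[of u h] adj_neq[of h u] by simp

lemma total_two_parents:
  assumes S: "u \<in> S" "a \<in> S" "b \<in> S" and u: "adj a u" "adj b u" and ab: "a \<noteq> b"
    and level: "d x u = Suc (d x a)" "d x b = d x a"
  shows "4 \<le> total"
proof -
  have nadj: "\<not> adj a b"
    using no_triangle[OF S(3,1,2) u(2)] u(1) adj_sym by blast
  have "2 \<le> excess x u"
    using excess_two_parents x u ab level by blast
  moreover have "1 \<le> excess x a"
    using excess_sibling x u ab nadj level by blast
  moreover have "1 \<le> excess x b"
    using excess_sibling[OF x u(2,1)] ab nadj level adj_commute by (metis (full_types))
  moreover have "u \<noteq> a" "u \<noteq> b"
    using u adj_neq by blast+
  \<comment> \<open>The gate is the only vertex of \<open>S\<close> closest to \<open>x\<close>,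
    whereas for each of these three another vertex of \<open>S\<close> is no farther from
    \<open>x\<close>.\<close>
  moreover have "p \<notin> {u, a, b}"
    using not_gate_if_closer[of u a] not_gate_if_closer[of a b] not_gate_if_closer[of b a]
      S ab level \<open>u \<noteq> a\<close> by auto
  ultimately show ?thesis
    using sum_le_total[of "{u, a, b}"] S ab by auto
qed

text \<open>Each sibling \<open>h\<close> contributes the arc from a parent of \<open>h\<close> to
  \<open>h\<close>: without triangles, that parent is at distance at least 2 from \<open>u\<close>,
  while \<open>h\<close> is adjacent to \<open>u\<close>.\<close>

lemma card_siblings_le_excess:
  assumes u: "u \<in> S" "u \<noteq> p"
  shows "card (siblings u) \<le> excess x u"
proof -
  have "\<forall>h\<in>S - {p}. \<exists>a. a \<in> S \<and> adj a h \<and> d x h = Suc (d x a)"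
    using ex_parent by blast
  then obtain par where par: "\<And>h. h \<in> S \<Longrightarrow> h \<noteq> p \<Longrightarrow>
      par h \<in> S \<and> adj (par h) h \<and> d x h = Suc (d x (par h))"
    by (metis DiffI singletonD)
  have sib: "h \<in> S" "adj h u" "d x h = d x u" if "h \<in> siblings u" for h
    using that unfolding siblings_def by auto
  have sib_p: "h \<noteq> p" if "h \<in> siblings u" for h
    using siblings_not_gate[OF sib(1)[OF that] siblings_sym[OF u(1) that]] .
  let ?F = "(\<lambda>h. (par h, h)) ` siblings u"
  have "card ?F \<le> excess x u"
  proof (rule card_le_excess)
    show "?F \<subseteq> opposing x u"
    proof clarify
      fix h assume h: "h \<in> siblings u"
      note par_h = par[OF sib(1)[OF h] sib_p[OF h]]
      have "par h \<noteq> u"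
        using par_h sib(3)[OF h] by auto
      moreover have "\<not> adj u (par h)"
        using no_triangle[OF _ sib(1)[OF h] u(1), of "par h"] par_h sib(2)[OF h] by blast
      ultimately have "d u (par h) \<noteq> 0" "d u (par h) \<noteq> 1"
        using d_eq_0 adj_if_d_1 par_h u S_V by metis+
      moreover have "d u h = 1"
        using sib(2)[OF h] d_adj adj_sym by blast
      ultimately show "(par h, h) \<in> opposing x u"
        using par_h unfolding opposing_def by simp
    qed
    fix i assume i: "i < d x u"
    show "\<exists>a b. (a, b) \<in> opposing x u - ?F \<and> d x a = i"
    proof (cases "Suc i = d x u")
      case True
      have "d u u = 0" "d u (par u) = 1"
        using u par d_eq_0 S_V d_adj adj_sym by blast+
      then have "(par u, u) \<in> opposing x u"
        using par[OF u] unfolding opposing_def by simp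
      moreover have "u \<notin> siblings u"
        using adj_neq unfolding siblings_def by blast
      ultimately show ?thesis
        using True par[OF u] by (intro exI[of _ "par u"] exI[of _ u]) auto
    next
      case False
      then show ?thesis
        using ex_geodesic_arc[OF x S_V[OF u(1)] i] sib(3) by fastforce
    qed
  qed
  moreover have "card ?F = card (siblings u)"
    by (intro card_image inj_onI) simp
  ultimately show ?thesis by simp
qed

text \<open>The pairs are ordered, so each edge inside a level counts twice.\<close>

lemma card_siblings_le_total:
  assumes "P \<subseteq> Sigma S siblings"
  shows "card P \<le> total"
proof -
  have fin: "finite (siblings u)" for u
    unfolding siblings_def using finite_S by simp
  have "P \<subseteq> Sigma (S - {p}) siblings"
    using assms siblings_not_gate by fastforce
  then have "card P \<le> card (Sigma (S - {p}) siblings)"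
    using finite_S fin by (intro card_mono) auto
  also have "\<dots> = (\<Sum>u\<in>S - {p}. card (siblings u))"
    using finite_S fin by (intro card_SigmaI) auto
  also have "\<dots> \<le> total"
    unfolding total_def by (intro sum_mono card_siblings_le_excess) auto
  finally show ?thesis .
qed

lemma ex_farthest:
  assumes "X \<subseteq> S" "X \<noteq> {}"
  shows "\<exists>l\<in>X. \<forall>r\<in>X. d x r \<le> d x l"
proof -
  have fin: "finite (d x ` X)"
    using assms finite_S finite_subset by blast
  then have "Max (d x ` X) \<in> d x ` X"
    using assms by (intro Max_in) auto
  then obtain l where "l \<in> X" "Max (d x ` X) = d x l"
    by blast
  with fin show ?thesis by (metis Max_ge imageI)
qed

section \<open>No vertex of \<open>S\<close> has two parents\<close>

context
  assumes unique_parent: "\<And>u a b. \<lbrakk>u \<in> S; a \<in> S; b \<in> S; adj a u; adj b u;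
    d x u = Suc (d x a); d x u = Suc (d x b)\<rbrakk> \<Longrightarrow> a = b"
begin

text \<open>A vertex of \<open>S\<close> farthest from \<open>x\<close> has at most one parent and
  no child in \<open>S\<close>. Its second neighbour must therefore lie on its own level.\<close>

lemma ex_siblings: "\<exists>l y. l \<in> S \<and> y \<in> siblings l"
proof -
  obtain l where l: "l \<in> S" "\<And>r. r \<in> S \<Longrightarrow> d x r \<le> d x l"
    using ex_farthest[of S] p by blast
  have "\<exists>q. \<forall>r\<in>S. adj r l \<and> d x l = Suc (d x r) \<longrightarrow> r = q"
    using unique_parent l(1) by metis
  then obtain q where q: "\<And>r. \<lbrakk>r \<in> S; adj r l; d x l = Suc (d x r)\<rbrakk> \<Longrightarrow> r = q"
    by blast
  obtain r where r: "r \<in> S" "r \<noteq> q" "adj l r"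
    using nonsep_neighbour[of S l q] block card_S l(1) unfolding block_set_def by blast
  from r(3) have "d x r = d x l"
    using r q l(2)[OF r(1)] adj_sym by (cases rule: d_adj_cases) auto
  then show ?thesis
    using l r adj_sym unfolding siblings_def by blast
qed

section \<open>Only one edge of \<open>S\<close> inside a level\<close>

context
  fixes l y
  assumes ly: "l \<in> S" "y \<in> siblings l"
    and only: "\<And>u h. \<lbrakk>u \<in> S; h \<in> siblings u\<rbrakk> \<Longrightarrow> {u, h} = {l, y}"
begin

lemma not_adj_level:
  assumes "u \<in> S" "h \<in> S" "adj u h" "u \<notin> {l, y}"
  shows "d x u \<noteq> d x h"
proof
  assume "d x u = d x h"
  then have "h \<in> siblings u"
    using assms adj_sym unfolding siblings_def by simp
  from only[OF assms(1) this] show False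
    using assms(4) by blast
qed

text \<open>The parents \<open>l'\<close> and \<open>y'\<close> of the two ends are distinct and not
  adjacent. Beyond distance 2, all four vertices have positive excess. At distance 2, a common
  neighbour \<open>c\<close> is a parent of both; if \<open>c\<close> is not \<open>p\<close>, it
  would separate its descendants from \<open>p\<close>.\<close>

lemma total_or_pentagon: "4 \<le> total \<or> pentagon S"
proof -
  have y: "y \<in> S" "adj l y" "d x y = d x l"
    using ly unfolding siblings_def by (auto simp: adj_commute)
  have "l \<noteq> p" "y \<noteq> p" "l \<noteq> y"
    using ly siblings_sym siblings_not_gate y adj_neq by blast+
  obtain l' y' where l': "l' \<in> S" "adj l' l" "d x l = Suc (d x l')"
    and y': "y' \<in> S" "adj y' y" "d x y = Suc (d x y')"
    using ex_parent ly(1) y(1) \<open>l \<noteq> p\<close> \<open>y \<noteq> p\<close> by metis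
  have level: "d x l' = d x y'"
    using l' y' y by simp
  have out: "l' \<notin> {l, y}" "y' \<notin> {l, y}"
    using l' y' y by auto
  have neq: "l' \<noteq> y'"
    using no_triangle[OF l'(1) ly(1) y(1) l'(2) y(2)] y'(2) adj_sym by blast
  have nadj: "\<not> adj l' y'"
    using not_adj_level[OF l'(1) y'(1)] out level by blast
  have not_p: "l' \<noteq> p" "y' \<noteq> p"
    using not_gate_if_closer[OF l'(1) y'(1)] not_gate_if_closer[OF y'(1) l'(1)] neq level by auto
  have d_ne: "d l' y' \<noteq> 0" "d l' y' \<noteq> 1"
    using d_eq_0 adj_if_d_1 neq nadj l' y' S_V by metis+
  show ?thesis
  proof (cases "d l' y' = 2")
    case False
    \<comment> \<open>The counted arc is \<open>(b', b)\<close> for the pair \<open>(x, a')\<close>: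
      the path over \<open>a\<close> shows that \<open>b\<close> is at distance at most 2 from
      \<open>a'\<close>.\<close>
    have far: "1 \<le> excess x a'" if "a' \<in> S" "b' \<in> S" "adj a' a" "adj a b" "adj b' b"
      "d x a' = d x b'" "d x b = Suc (d x b')" "2 < d a' b'" for a a' b b'
    proof (rule excess_pos[OF x S_V[OF that(1)] that(5)])
      have "d a' b \<le> 2"
        using d_adj_le[OF S_V[OF that(1)] that(4)] d_adj[OF that(3)] by simp
      then show "d a' b < d a' b'"
        using that by simp
    qed (use that(6,7) in simp_all)
    have "1 \<le> excess x l'"
      using far[OF l'(1) y'(1) l'(2) y(2) y'(2)] level y' d_ne False by simp
    moreover have "1 \<le> excess x y'"
      using far[OF y'(1) l'(1) y'(2) adj_sym[OF y(2)] l'(2)] level l' d_ne False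
      by (simp add: d_sym)
    moreover have "1 \<le> excess x u" if "u \<in> S" "h \<in> siblings u" for u h
    proof -
      have "card {h} \<le> card (siblings u)"
        using that finite_S unfolding siblings_def by (intro card_mono) auto
      then show ?thesis
        using card_siblings_le_excess[of u] that siblings_not_gate by fastforce
    qed
    then have "1 \<le> excess x l" "1 \<le> excess x y"
      using ly y siblings_sym by blast+
    ultimately have "4 \<le> (\<Sum>u\<in>{l, y, l', y'}. excess x u)"
      using \<open>l \<noteq> y\<close> neq out by auto
    also have "\<dots> \<le> total"
      using ly y l' y' \<open>l \<noteq> p\<close> \<open>y \<noteq> p\<close> not_p by (intro sum_le_total) auto
    finally show ?thesis by blast
  next
    case True
    then have "d l' y' = Suc 1" by simp
    then obtain c where c: "adj c y'" "d l' c = 1"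
      using d_parent l' y' S_V by metis
    have l'c: "adj l' c"
      using adj_if_d_1 S_V l'(1) adj_V c by blast
    have cS: "c \<in> S"
      using block_convex[OF block l'(1) y'(1)] adj_V c d_adj True by simp
    \<comment> \<open>A child \<open>c\<close> of \<open>l'\<close> would have the two parents
      \<open>l'\<close> and \<open>y'\<close>; a sibling \<open>c\<close> would give a second edge
      inside a level.\<close>
    from l'c have cl': "d x l' = Suc (d x c)"
    proof (cases rule: d_adj_cases)
      case 1
      then have "l' = y'"
        using unique_parent[OF cS l'(1) y'(1) l'c] c(1) adj_sym level by simp
      then show ?thesis using neq by blast
    next
      case 2
      then show ?thesis
        using not_adj_level[OF l'(1) cS l'c] out by simp
    qed
    show ?thesis
    proof (cases "c = p")
      case True
      have "S = {p, l', l, y, y'}"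
      proof (rule ccontr)
        assume "\<not> ?thesis"
        then have "S - {p, l', l, y, y'} \<noteq> {}"
          using p l' ly y y' by blast
        \<comment> \<open>A farthest remaining vertex \<open>w\<close> has a parent \<open>a\<close>
          and a further neighbour \<open>r\<close>. A child \<open>r\<close> would be among the five
          vertices, but apart from \<open>p\<close> these have their unique parents among the five.
          The other levels for \<open>r\<close> contradict \<open>only\<close> or
          \<open>unique_parent\<close>.\<close>
        then obtain w where w: "w \<in> S - {p, l', l, y, y'}"
          "\<And>r. r \<in> S - {p, l', l, y, y'} \<Longrightarrow> d x r \<le> d x w"
          using ex_farthest[of "S - {p, l', l, y, y'}"] by blast
        then obtain a where a: "a \<in> S" "adj a w" "d x w = Suc (d x a)"
          using ex_parent by blast
        obtain r where r: "r \<in> S" "r \<noteq> a" "adj w r"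
          using nonsep_neighbour[of S w a] block card_S w(1) unfolding block_set_def by blast
        from r(3) show False
        proof (cases rule: d_adj_cases)
          case 1
          then have "r \<in> {p, l', l, y, y'}"
            using w(2)[of r] r(1) by force
          moreover have "r \<noteq> p"
            using gate_closest[of w] w(1) 1 by auto
          moreover have "s = w" if "s \<in> S" "adj s r" "d x r = Suc (d x s)" for s
            using unique_parent[of r s w] that r w(1) 1 by blast
          ultimately show False
            using l' y' c l'c cS cl' level True w(1) adj_sym by (metis DiffD2 insertCI insertE empty_iff)
        next
          case 2
          then show False
            using not_adj_level[of w r] w(1) r by auto
        next
          case 3
          then show False
            using unique_parent[of w a r] a r w(1) adj_sym by blast
        qed
      qed
      moreover have "distinct [p, l', l, y, y']"
        using \<open>l \<noteq> p\<close> \<open>y \<noteq> p\<close> \<open>l \<noteq> y\<close> neq not_p out by auto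
      moreover have "adj p l'" "adj l' l" "adj l y" "adj y y'" "adj y' p"
        using True l'c l'(2) y(2) y'(2) c(1) adj_sym by blast+
      ultimately have "pentagon S"
        unfolding pentagon_def by metis
      then show ?thesis ..
    next
      case False
      \<comment> \<open>The descendants of \<open>c\<close> in \<open>S\<close>, that is, the
        vertices other than \<open>c\<close> that a geodesic from \<open>x\<close> reaches through
        \<open>c\<close>.\<close>
      define T where "T = {t \<in> S - {c}. d x t = d x c + d c t}"
      have T_child: "s \<in> T" if "t = c \<or> t \<in> T" "adj t s" "s \<in> S" "d x s = Suc (d x t)" for s t
      proof -
        have "d x t = d x c + d c t"
          using that(1) d_eq_0[of c c] cS S_V unfolding T_def by auto
        moreover have "d c s \<le> d c t + 1" "d x s \<le> d x c + d c s"
          using d_adj_le[of c t s] d_triangle[of x s c] that(2,3) cS S_V x by auto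
        ultimately show ?thesis
          using that(3,4) unfolding T_def by auto
      qed
      have "l' \<in> T" "y' \<in> T"
        using T_child[of c l'] T_child[of c y'] adj_sym[OF l'c] c(1) l'(1) y'(1) cl' level by simp_all
      then have lyT: "l \<in> T" "y \<in> T"
        using T_child[of l' l] T_child[of y' y] l'(2,3) y'(2,3) ly(1) y(1) by simp_all
      have "conn (S - {c})"
        using block nonsepD unfolding block_set_def by blast
      moreover have "T \<subseteq> S - {c}" "T \<noteq> {}"
        using lyT unfolding T_def by auto
      moreover have "p \<in> S - {c} - T"
        using False p gate_closest[OF cS] unfolding T_def by auto
      ultimately obtain t s where ts: "t \<in> T" "s \<in> S - {c} - T" "adj t s"
        unfolding conn_def by blast
      \<comment> \<open>An edge leaving \<open>T\<close> cannot lead to a child, which is again a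
        descendant, nor stay within a level, since both \<open>l\<close> and \<open>y\<close> are in
        \<open>T\<close>. It cannot lead to the parent either, which is unique and lies towards
        \<open>c\<close>.\<close>
      from ts(3) have False
      proof (cases rule: d_adj_cases)
        case 1
        then show ?thesis using T_child ts by blast
      next
        case 2
        then have "{t, s} = {l, y}"
          using only[of t s] ts unfolding siblings_def T_def by (auto simp: adj_commute)
        then show ?thesis
          using lyT ts(2) by (auto simp: doubleton_eq_iff)
      next
        case 3
        obtain a where a: "a \<in> S" "adj a t" "d x t = Suc (d x a)" "d x a = d x c + d c a"
          using parent_towards[OF cS, of t] ts(1) unfolding T_def by blast
        then have "a = s"
          using unique_parent[of t a s] ts 3 adj_sym unfolding T_def by blast
        then show ?thesis
          using a ts(2) unfolding T_def by blast
      qed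
      then show ?thesis ..
    qed
  qed
qed

end

end

text \<open>With unique parents, one edge inside a level yields two ordered pairs of siblings, hence
  the bound 2, and a second such edge yields four pairs.\<close>

lemma total_ge: "2 \<le> total \<and> (4 \<le> total \<or> pentagon S)"
proof (cases "\<exists>u a b. u \<in> S \<and> a \<in> S \<and> b \<in> S \<and> adj a u \<and> adj b u \<and>
    d x u = Suc (d x a) \<and> d x u = Suc (d x b) \<and> a \<noteq> b")
  case True
  then have "4 \<le> total"
    using total_two_parents by (metis Suc_inject)
  then show ?thesis by simp
next
  case False
  then have unique: "\<And>u a b. \<lbrakk>u \<in> S; a \<in> S; b \<in> S; adj a u; adj b u;
      d x u = Suc (d x a); d x u = Suc (d x b)\<rbrakk> \<Longrightarrow> a = b"
    by blast
  have "\<exists>l y. l \<in> S \<and> y \<in> siblings l"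
    by (rule ex_siblings) (rule unique)
  then obtain l y where ly: "l \<in> S" "y \<in> siblings l"
    by blast
  have pair: "{(u, h), (h, u)} \<subseteq> Sigma S siblings" "u \<noteq> h" if "u \<in> S" "h \<in> siblings u" for u h
    using that siblings_sym[OF that] adj_neq[of h u] unfolding siblings_def by auto
  have "2 \<le> total"
    using card_siblings_le_total[OF pair(1)[OF ly]] pair(2)[OF ly] by simp
  moreover have "4 \<le> total \<or> pentagon S"
  proof (cases "\<exists>u h. u \<in> S \<and> h \<in> siblings u \<and> {u, h} \<noteq> {l, y}")
    case True
    then obtain u h where uh: "u \<in> S" "h \<in> siblings u" "{u, h} \<noteq> {l, y}"
      by blast
    have "card {(l, y), (y, l), (u, h), (h, u)} = 4"
      using pair(2)[OF ly] pair(2)[OF uh(1,2)] uh(3) by (auto simp: doubleton_eq_iff)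
    then show ?thesis
      using card_siblings_le_total[of "{(l, y), (y, l), (u, h), (h, u)}"]
        pair(1)[OF ly] pair(1)[OF uh(1,2)] by simp
  next
    case False
    show ?thesis
    proof (rule total_or_pentagon[OF _ ly])
      show "{u, h} = {l, y}" if "u \<in> S" "h \<in> siblings u" for u h
        using False that by blast
    qed (rule unique)
  qed
  ultimately show ?thesis ..
qed

end

section \<open>From a single vertex to the sum over all vertices\<close>

context metric_graph
begin

definition triangle_free_set :: "'a set \<Rightarrow> bool" where
  "triangle_free_set S \<longleftrightarrow> (\<nexists>a b c. a \<in> S \<and> b \<in> S \<and> c \<in> S \<and> adj a b \<and> adj b c \<and> adj c a)"

lemma block_excess:
  assumes S: "block_set S" "3 \<le> card S" "triangle_free_set S"
  shows "\<exists>g. \<forall>x\<in>V. g x \<in> S \<and> (\<forall>y\<in>S. d x y = d x (g x) + d (g x) y) \<and>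
    2 \<le> (\<Sum>u\<in>S - {g x}. excess x u) \<and> (4 \<le> (\<Sum>u\<in>S - {g x}. excess x u) \<or> pentagon S)"
proof -
  have "\<exists>p. p \<in> S \<and> (\<forall>y\<in>S. d x y = d x p + d p y) \<and>
    2 \<le> (\<Sum>u\<in>S - {p}. excess x u) \<and> (4 \<le> (\<Sum>u\<in>S - {p}. excess x u) \<or> pentagon S)"
    if x: "x \<in> V" for x
  proof -
    obtain p where pS: "p \<in> S" and p_gate: "\<And>y. y \<in> S \<Longrightarrow> d x y = d x p + d p y"
      using ex_gate S(1) x by blast
    interpret triangle_free_block V adj d S x p
    proof
      show "\<not> adj c a" if "a \<in> S" "b \<in> S" "c \<in> S" "adj a b" "adj b c" for a b c
        using that S(3) unfolding triangle_free_set_def by blast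
    qed (fact S x pS p_gate)+
    show ?thesis
      using pS p_gate total_ge[unfolded total_def] by blast
  qed
  then show ?thesis
    by (intro bchoice ballI)
qed

lemma block_set_subset: "block_set S \<Longrightarrow> S \<subseteq> V"
  unfolding block_set_def by blast

lemma sum_excess_ge_if_not_pentagon:
  assumes S: "block_set S" "3 \<le> card S" "triangle_free_set S" and "\<not> pentagon S"
  shows "4 * card V \<le> (\<Sum>x\<in>V. \<Sum>u\<in>V. excess x u)"
proof -
  obtain g where g: "\<And>x. x \<in> V \<Longrightarrow> 4 \<le> (\<Sum>u\<in>S - {g x}. excess x u)"
    using block_excess[OF S] assms(4) by blast
  have "4 \<le> (\<Sum>u\<in>V. excess x u)" if "x \<in> V" for x
  proof -
    have "(\<Sum>u\<in>S - {g x}. excess x u) \<le> (\<Sum>u\<in>V. excess x u)"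
      using block_set_subset[OF S(1)] finite_V by (intro sum_mono2) auto
    with g[OF that] show ?thesis by simp
  qed
  then have "(\<Sum>x\<in>V. 4) \<le> (\<Sum>x\<in>V. \<Sum>u\<in>V. excess x u)"
    by (intro sum_mono)
  then show ?thesis by simp
qed

lemma conn_Un:
  assumes "conn A" "conn B" "A \<inter> B \<noteq> {}"
  shows "conn (A \<union> B)"
proof (rule connI[OF assms(1)])
  fix T assume T: "T \<subseteq> A \<union> B - A" "T \<noteq> {}"
  then have "T \<subseteq> B" "T \<noteq> B"
    using assms(3) by auto
  with assms(2) T(2) obtain t s where "t \<in> T" "s \<in> B - T" "adj t s"
    unfolding conn_def by blast
  then show "\<exists>t\<in>T. \<exists>s\<in>A \<union> B - T. adj t s"
    by blast
qed blast

text \<open>After removing any \<open>w\<close>, one of \<open>p\<close> and \<open>q\<close> still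
  lies in both blocks, so their union stays connected, and maximality applies to both.\<close>

lemma block_set_eq_if_two_common:
  assumes S: "block_set S" and T: "block_set T" and pq: "p \<in> S \<inter> T" "q \<in> S \<inter> T" "p \<noteq> q"
  shows "S = T"
proof -
  have nonsep: "nonsep S" "nonsep T"
    using S T unfolding block_set_def by blast+
  then have "conn (S \<union> T)"
    using pq unfolding nonsep_def by (blast intro: conn_Un)
  moreover have "conn (S \<union> T - {w})" for w
  proof -
    have "(S - {w}) \<inter> (T - {w}) \<noteq> {}"
      using pq by blast
    then show ?thesis
      unfolding Un_Diff using nonsep nonsepD conn_Un by blast
  qed
  ultimately have "nonsep (S \<union> T)"
    unfolding nonsep_def by blast
  moreover have "S \<union> T \<subseteq> V"
    using S T block_set_subset by blast
  ultimately have "S \<union> T = S" "S \<union> T = T"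
    using S T Un_upper1[of S T] Un_upper2[of T S] unfolding block_set_def by simp_all
  then show ?thesis by blast
qed

text \<open>
  The excesses contributed by the first block are counted as ordered pairs in both directions. The
  second block adds its inner pairs, which are new: if such a pair meets the first block in a vertex
  \<open>a\<close>, then \<open>a\<close> is the gate of the other vertex, and pairs of a vertex with its gate are not counted.
\<close>

lemma sum_excess_ge_two_blocks:
  assumes S: "block_set S" "3 \<le> card S" "triangle_free_set S"
    and T: "block_set T" "3 \<le> card T" "triangle_free_set T"
    and ne: "S \<noteq> T" and le: "card S \<le> card T"
  shows "4 * card V \<le> (\<Sum>x\<in>V. \<Sum>u\<in>V. excess x u)"
proof -
  obtain g where g: "\<And>x. x \<in> V \<Longrightarrow> g x \<in> S"
    "\<And>x y. \<lbrakk>x \<in> V; y \<in> S\<rbrakk> \<Longrightarrow> d x y = d x (g x) + d (g x) y"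
    "\<And>x. x \<in> V \<Longrightarrow> 2 \<le> (\<Sum>u\<in>S - {g x}. excess x u)"
    using block_excess[OF S] by metis
  obtain h where h: "\<And>x. x \<in> V \<Longrightarrow> h x \<in> T"
    "\<And>x y. \<lbrakk>x \<in> V; y \<in> T\<rbrakk> \<Longrightarrow> d x y = d x (h x) + d (h x) y"
    "\<And>x. x \<in> V \<Longrightarrow> 2 \<le> (\<Sum>u\<in>T - {h x}. excess x u)"
    using block_excess[OF T] by metis
  have SV: "S \<subseteq> V" and TV: "T \<subseteq> V"
    using S T block_set_subset by auto
  then have fin: "finite S" "finite T"
    using finite_V finite_subset by blast+
  have h_T: "h x = x" if "x \<in> T" for x
  proof -
    have "x \<in> V" using that TV by blast
    then have "d x (h x) = 0"
      using h(2)[of x x] that d_eq_0[of x x] by simp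
    then show ?thesis
      using \<open>x \<in> V\<close> d_eq_0[of x "h x"] h(1)[of x] TV by auto
  qed
  \<comment> \<open>\<open>g x\<close> lies between \<open>x\<close> and \<open>a\<close>, hence in
    \<open>T\<close> by convexity, and distinct blocks share at most one vertex.\<close>
  have gate: "g x = a" if "x \<in> T" "a \<in> S" "a \<in> T" for x a
  proof -
    have xV: "x \<in> V" using that TV by blast
    have "g x \<in> T"
      using block_convex[OF T(1) that(1,3) _ g(2)[OF xV that(2), symmetric]] g(1)[OF xV] SV by blast
    then show ?thesis
      using block_set_eq_if_two_common[OF S(1) T(1), of "g x" a] g(1)[OF xV] that ne by blast
  qed
  define e where "e = (\<lambda>(x, u). excess x u)"
  define R1 where "R1 = (SIGMA x:V. S - {g x})"
  define R2 where "R2 = (SIGMA x:V - S. S - {g x})"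
  define R3 where "R3 = (SIGMA x:T. T - {h x})"
  note R_defs = R1_def R2_def R3_def
  have fin_R: "finite R1" "finite R2" "finite R3"
    unfolding R_defs using fin finite_V by auto
  have ge: "2 * card X \<le> (\<Sum>q\<in>(SIGMA x:X. Y - {k x}). e q)"
    if "X \<subseteq> V" "finite Y" "\<And>x. x \<in> V \<Longrightarrow> 2 \<le> (\<Sum>u\<in>Y - {k x}. excess x u)" for X Y k
  proof -
    have "2 * card X = (\<Sum>x\<in>X. 2)"
      by simp
    also have "\<dots> \<le> (\<Sum>x\<in>X. \<Sum>u\<in>Y - {k x}. excess x u)"
      using that by (intro sum_mono) blast
    also have "\<dots> = (\<Sum>q\<in>(SIGMA x:X. Y - {k x}). e q)"
      unfolding e_def using that finite_V finite_subset by (subst sum.Sigma) auto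
    finally show ?thesis .
  qed
  have "2 * card V \<le> sum e R1" "2 * card (V - S) \<le> sum e R2" "2 * card T \<le> sum e R3"
    unfolding R_defs using ge[of V S g] ge[of "V - S" S g] ge[of T T h] g h fin TV by blast+
  moreover have "card (V - S) = card V - card S" "card S \<le> card V"
    using SV fin finite_V by (auto simp: card_Diff_subset card_mono)
  \<comment> \<open>The three bounds add up to
    \<open>2 * card V + 2 * (card V - card S) + 2 * card T\<close>, which is where \<open>le\<close>
    enters.\<close>
  ultimately have "4 * card V \<le> sum e R1 + sum e R2 + sum e R3"
    using le by simp
  also have "sum e R2 = sum e (prod.swap ` R2)"
    by (subst sum.reindex) (auto simp: e_def excess_commute intro!: sum.cong)
  also have "sum e R1 + sum e (prod.swap ` R2) + sum e R3 = sum e (R1 \<union> prod.swap ` R2 \<union> R3)"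
  proof -
    have "R1 \<inter> prod.swap ` R2 = {}"
      unfolding R_defs by auto
    moreover have "(R1 \<union> prod.swap ` R2) \<inter> R3 = {}"
      unfolding R_defs using gate h_T by auto
    ultimately show ?thesis
      using fin_R by (simp add: sum.union_disjoint)
  qed
  also have "\<dots> \<le> sum e (V \<times> V)"
    using finite_V SV TV unfolding R_defs by (intro sum_mono2) auto
  also have "\<dots> = (\<Sum>x\<in>V. \<Sum>u\<in>V. excess x u)"
    unfolding e_def by (simp add: sum.cartesian_product)
  finally show ?thesis .
qed

end

subsection \<open>Transfer to the graph\<close>

text \<open>Each edge is the image of exactly two arcs. This turns the Wiener and the Szeged index
  into sums over ordered pairs.\<close>

lemma sum_symmetric_arcs:
  fixes f :: "'a \<Rightarrow> 'a \<Rightarrow> nat"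
  assumes "finite R" "sym R" "irrefl R" and f: "\<And>a b. f a b = f b a"
  shows "(\<Sum>(a, b)\<in>R. f a b) = 2 * (\<Sum>e\<in>(\<lambda>(a, b). {a, b}) ` R. on_pair f e)"
proof -
  have fibre: "(\<Sum>(a, b)\<in>{q \<in> R. (\<lambda>(a, b). {a, b}) q = e}. f a b) = 2 * on_pair f e"
    if e: "e \<in> (\<lambda>(a, b). {a, b}) ` R" for e
  proof -
    obtain a b where ab: "(a, b) \<in> R" "e = {a, b}"
      using e by auto
    have "(b, a) \<in> R" "a \<noteq> b"
      using ab assms(2,3) by (auto dest: symD simp: irrefl_def)
    with ab have "{q \<in> R. (\<lambda>(a, b). {a, b}) q = e} = {(a, b), (b, a)}"
      by (auto simp: doubleton_eq_iff)
    then show ?thesis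
      using \<open>a \<noteq> b\<close> ab(2) f[of a b] by (simp add: on_pair_eq)
  qed
  have "(\<Sum>(a, b)\<in>R. f a b) = (\<Sum>e\<in>(\<lambda>(a, b). {a, b}) ` R.
      \<Sum>(a, b)\<in>{q \<in> R. (\<lambda>(a, b). {a, b}) q = e}. f a b)"
    using assms(1) by (rule sum.image_gen)
  also have "\<dots> = (\<Sum>e\<in>(\<lambda>(a, b). {a, b}) ` R. 2 * on_pair f e)"
    using fibre by (rule sum.cong[OF refl])
  finally show ?thesis
    by (simp add: sum_distrib_left)
qed

section \<open>Distances in a connected graph\<close>

context graph
begin

text \<open>\<open>graph_dist\<close> minimises over paths only, so a walk is first shortened by
  cutting out its closed parts.\<close>

lemma graph_dist_le:
  assumes "awalk u p v"
  shows "graph_dist G u v \<le> length p"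
proof -
  have "\<exists>q. apath u q v \<and> length q \<le> length p"
    using assms
  proof (induction rule: awalk_to_apath_induct)
    case (path p)
    then show ?case unfolding apath_def by blast
  next
    case (decomp p q r s)
    then have "p = q @ r @ s"
      using awalk_cyc_decomp_has_prop by fastforce
    with decomp show ?case by fastforce
  qed
  then obtain q where "apath u q v" "length q \<le> length p" by blast
  then show ?thesis
    unfolding graph_dist_def by (metis (mono_tags, lifting) Least_le le_trans)
qed

lemma ex_shortest_apath:
  assumes "u \<rightarrow>\<^sup>* v"
  shows "\<exists>p. apath u p v \<and> length p = graph_dist G u v"
proof -
  have "\<exists>k p. apath u p v \<and> length p = k"
    using assms unfolding reachable_apath by blast
  then show ?thesis
    unfolding graph_dist_def by (rule LeastI_ex)
qed

lemma connected_reachable: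
  assumes "Digraph_Component.connected G" "u \<in> verts G" "v \<in> verts G"
  shows "u \<rightarrow>\<^sup>* v"
  using assms reachable_mk_symmetric_eq[OF sym_arcs]
  unfolding connected_def strongly_connected_def by simp

lemma metric_graph:
  assumes "Digraph_Component.connected G"
  shows "metric_graph (verts G) (dominates G) (graph_dist G)"
proof
  note reach = connected_reachable[OF assms]
  show "finite (verts G)"
    by simp
  show "y \<rightarrow> x" if "x \<rightarrow> y" for x y
    using that by (rule graph_symmetric)
  show "x \<in> verts G" if "x \<rightarrow> y" for x y
    using that by (rule adj_in_verts)
  show dist0: "graph_dist G x y = 0 \<longleftrightarrow> x = y" if "x \<in> verts G" "y \<in> verts G" for x y
    using ex_shortest_apath[OF reach[OF that]] graph_dist_le[of x "[]" y] that
    by (auto simp: apath_Nil_iff awalk_Nil_iff)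
  show adj1: "graph_dist G x y = 1" if xy: "x \<rightarrow> y" for x y
  proof -
    obtain e where "e \<in> arcs G" "tail G e = x" "head G e = y"
      using xy by blast
    then have "graph_dist G x y \<le> 1"
      using graph_dist_le[of x "[e]" y] arc_implies_awalk by fastforce
    moreover have "x \<noteq> y"
      using adj_not_same xy by blast
    ultimately show ?thesis
      using dist0 adj_in_verts[OF xy] by fastforce
  qed
  show "graph_dist G x y = graph_dist G y x" for x y
    by (rule graph_dist_commute)
  show tri: "graph_dist G x y \<le> graph_dist G x z + graph_dist G z y"
    if V: "x \<in> verts G" "y \<in> verts G" "z \<in> verts G" for x y z
  proof -
    obtain p q where "apath x p z" "length p = graph_dist G x z"
      "apath z q y" "length q = graph_dist G z y"
      using ex_shortest_apath reach V by metis
    then show ?thesis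
      using graph_dist_le[of x "p @ q" y] awalkI_apath awalk_appendI by (metis length_append)
  qed
  show "\<exists>z. z \<rightarrow> y \<and> graph_dist G x z = k"
    if V: "x \<in> verts G" "y \<in> verts G" and k: "graph_dist G x y = Suc k" for x y k
  proof -
    obtain p where p: "awalk x p y" "length p = Suc k"
      using ex_shortest_apath[OF reach[OF V]] k awalkI_apath by metis
    then obtain q e where qe: "p = q @ [e]"
      by (metis length_Suc_conv_rev)
    define z where "z = tail G e"
    have e: "awalk x q z" "z \<rightarrow> y" "length q = k"
      using p qe in_arcs_imp_in_arcs_ends[of e] by (auto simp: awalk_simps z_def)
    have "graph_dist G x y \<le> graph_dist G x z + 1"
      using tri[OF V, of z] adj1[OF e(2)] adj_in_verts[OF e(2)] by simp
    then show ?thesis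
      using graph_dist_le[OF e(1)] e(2,3) k by (intro exI[of _ z]) simp
  qed
qed

end

locale connected_graph = graph +
  assumes connected: "Digraph_Component.connected G"

sublocale connected_graph \<subseteq> M: metric_graph "verts G" "dominates G" "graph_dist G"
  using metric_graph connected .

section \<open>The indices as sums over ordered pairs of vertices\<close>

context connected_graph
begin

lemma wiener_index_double: "2 * wiener_index G = (\<Sum>x\<in>verts G. \<Sum>u\<in>verts G. graph_dist G x u)"
proof -
  let ?R = "{(a, b). a \<in> verts G \<and> b \<in> verts G \<and> a \<noteq> b}"
  have fin: "finite ?R"
    by (rule finite_subset[of _ "verts G \<times> verts G"]) auto
  have "P \<in> (\<lambda>(a, b). {a, b}) ` ?R" if "P \<subseteq> verts G" "card P = 2" for P
  proof -
    obtain a b where "P = {a, b}" "a \<noteq> b"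
      using \<open>card P = 2\<close> unfolding card_2_iff by blast
    with that show ?thesis
      by (intro image_eqI[of _ _ "(a, b)"]) auto
  qed
  then have "(\<lambda>(a, b). {a, b}) ` ?R = {P. P \<subseteq> verts G \<and> card P = 2}"
    by auto
  then have "2 * wiener_index G = (\<Sum>(a, b)\<in>?R. graph_dist G a b)"
    unfolding wiener_index_def using fin graph_dist_commute
    by (subst sum_symmetric_arcs) (auto simp: sym_def irrefl_def)
  \<comment> \<open>Diagonal pairs have distance 0.\<close>
  also have "\<dots> = (\<Sum>(a, b)\<in>verts G \<times> verts G. graph_dist G a b)"
    using M.d_eq_0[of b b for b] by (intro sum.mono_neutral_left) auto
  finally show ?thesis
    by (simp add: sum.cartesian_product)
qed

text \<open>The product for an arc \<open>(a, b)\<close> counts the pairs \<open>(x, u)\<close> for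
  which this arc is opposing, so exchanging the two sums gives the claim.\<close>

lemma szeged_index_double:
  "2 * szeged_index G = (\<Sum>x\<in>verts G. \<Sum>u\<in>verts G. card (M.opposing x u))"
proof -
  define P where "P = (\<lambda>(a, b) (x, u).
    graph_dist G x a < graph_dist G x b \<and> graph_dist G u b < graph_dist G u a)"
  let ?V = "verts G \<times> verts G"
  let ?f = "\<lambda>a b. closer_count G a b * closer_count G b a"
  have fin: "finite (arcs_ends G)"
    by (simp add: arcs_ends_conv)
  have "edges G = (\<lambda>(a, b). {a, b}) ` arcs_ends G"
    unfolding edges_def arcs_ends_conv by (simp add: image_image)
  moreover have "sym (arcs_ends G)" "irrefl (arcs_ends G)"
    using graph_symmetric adj_not_same by (auto simp: sym_def irrefl_def)
  ultimately have "2 * szeged_index G = (\<Sum>(a, b)\<in>arcs_ends G. ?f a b)"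
    unfolding szeged_index_def using fin by (subst sum_symmetric_arcs) (auto simp: mult.commute)
  also have "\<dots> = (\<Sum>e\<in>arcs_ends G. card {q \<in> ?V. P e q})"
  proof (intro sum.cong refl)
    fix e assume "e \<in> arcs_ends G"
    obtain a b where e: "e = (a, b)" by fastforce
    have "{q \<in> ?V. P e q} = {w \<in> verts G. graph_dist G w a < graph_dist G w b} \<times>
        {w \<in> verts G. graph_dist G w b < graph_dist G w a}"
      unfolding e P_def by auto
    then show "(case e of (a, b) \<Rightarrow> ?f a b) = card {q \<in> ?V. P e q}"
      unfolding closer_count_def by (simp add: e card_cartesian_product)
  qed
  also have "\<dots> = (\<Sum>e\<in>arcs_ends G. \<Sum>q\<in>?V. if P e q then 1 else 0)"
    by (intro sum.cong refl) (simp flip: sum.inter_filter)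
  also have "\<dots> = (\<Sum>q\<in>?V. \<Sum>e\<in>arcs_ends G. if P e q then 1 else 0)"
    by (rule sum.swap)
  also have "\<dots> = (\<Sum>(x, u)\<in>?V. card (M.opposing x u))"
  proof (intro sum.cong refl)
    fix q assume "q \<in> ?V"
    obtain x u where q: "q = (x, u)" by fastforce
    have "M.opposing x u = {e \<in> arcs_ends G. P e q}"
      unfolding M.opposing_def q P_def by auto
    then show "(\<Sum>e\<in>arcs_ends G. if P e q then 1 else 0) =
        (case q of (x, u) \<Rightarrow> card (M.opposing x u))"
      using fin by (simp add: q flip: sum.inter_filter)
  qed
  finally show ?thesis
    by (simp add: sum.cartesian_product)
qed

lemma eta_double: "2 * eta G = int (\<Sum>x\<in>verts G. \<Sum>u\<in>verts G. M.excess x u)"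
proof -
  have "(\<Sum>x\<in>verts G. \<Sum>u\<in>verts G. card (M.opposing x u)) =
      (\<Sum>x\<in>verts G. \<Sum>u\<in>verts G. graph_dist G x u + M.excess x u)"
    using M.d_le_card_opposing unfolding M.excess_def by (intro sum.cong refl) simp
  then have "2 * szeged_index G =
      2 * wiener_index G + (\<Sum>x\<in>verts G. \<Sum>u\<in>verts G. M.excess x u)"
    unfolding szeged_index_double wiener_index_double by (simp add: sum.distrib)
  then have "2 * int (szeged_index G) =
      2 * int (wiener_index G) + int (\<Sum>x\<in>verts G. \<Sum>u\<in>verts G. M.excess x u)"
    by (metis (no_types, lifting) of_nat_add of_nat_mult of_nat_numeral)
  then show ?thesis
    unfolding eta_def by simp
qed

section \<open>Blocks and their vertex sets\<close>

lemma conn_if_reachable: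
  assumes reach: "\<And>u v. \<lbrakk>u \<in> X; v \<in> X\<rbrakk> \<Longrightarrow> (u, v) \<in> rtrancl_on X r"
    and r: "\<And>u v. (u, v) \<in> r \<Longrightarrow> u \<rightarrow> v"
  shows "M.conn X"
  unfolding M.conn_def
proof (intro allI impI)
  fix T assume T: "T \<subseteq> X" "T \<noteq> {}" "T \<noteq> X"
  then obtain u v where uv: "u \<in> T" "v \<in> X - T" by blast
  show "\<exists>t\<in>T. \<exists>s\<in>X - T. t \<rightarrow> s"
  proof (rule ccontr)
    assume closed: "\<not> ?thesis"
    have "(u, v) \<in> rtrancl_on X r"
      using reach uv T by blast
    then have "v \<in> T"
    proof (induction rule: rtrancl_on_induct)
      case base
      show ?case by (rule uv(1))
    next
      case (step y z)
      then show ?case using closed r by blast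
    qed
    then show False using uv by blast
  qed
qed

lemma reachable_if_conn:
  assumes "M.conn X" "u \<in> X" "v \<in> X"
  shows "u \<rightarrow>\<^sup>*\<^bsub>G \<restriction> X\<^esub> v"
proof (rule ccontr)
  assume not_reach: "\<not> ?thesis"
  interpret H: wf_digraph "G \<restriction> X"
    by (rule wellformed_induce_subgraph)
  let ?T = "{t \<in> X. u \<rightarrow>\<^sup>*\<^bsub>G \<restriction> X\<^esub> t}"
  have "u \<in> ?T"
    using assms by (simp add: H.reachable_refl)
  then obtain t s where ts: "t \<in> ?T" "s \<in> X - ?T" "t \<rightarrow> s"
    using assms not_reach unfolding M.conn_def
    by (metis (no_types, lifting) empty_iff mem_Collect_eq subsetI)
  then have "t \<rightarrow>\<^bsub>G \<restriction> X\<^esub> s"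
    by (force simp: arcs_ends_conv)
  then show False
    using ts H.reachable_adj_trans by blast
qed

text \<open>Deleting \<open>v\<close> from the subgraph induced by \<open>T\<close> leaves the one
  induced by \<open>T - {v}\<close>, so removing a vertex means the same for graphs and for vertex
  sets.\<close>

lemma induced_block:
  assumes T: "T \<subseteq> verts G" "T \<noteq> {}" "M.nonsep T"
  shows "graph (G \<restriction> T) \<and> Digraph_Component.connected (G \<restriction> T) \<and> (\<nexists>v. cut_vertex (G \<restriction> T) v)"
proof (intro conjI notI)
  have ind: "induced_subgraph (G \<restriction> T) G"
    using T(1) by blast
  interpret H: digraph "G \<restriction> T"
    using ind by (rule digraphI_induced)
  interpret H: sym_digraph "G \<restriction> T"
    using ind by (rule induced_graph_imp_graph)
  show "graph (G \<restriction> T)"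
    using H.sym_arcs by (rule H.graphI)
  show "Digraph_Component.connected (G \<restriction> T)"
    using reachable_if_conn T(2,3) H.reachable_mk_symmetric_eq[OF H.sym_arcs]
    unfolding connected_def M.nonsep_def by (intro strongly_connectedI) auto
  assume "\<exists>v. cut_vertex (G \<restriction> T) v"
  then obtain v u w where uw: "u \<in> T - {v}" "w \<in> T - {v}"
    "\<not> u \<rightarrow>\<^sup>*\<^bsub>pre_digraph.del_vert (G \<restriction> T) v\<^esub> w"
    unfolding cut_vertex_def by auto
  have "pre_digraph.del_vert (G \<restriction> T) v = G \<restriction> (T - {v})"
    by (auto simp: pre_digraph.del_vert_def induce_subgraph_def)
  moreover have "M.conn (T - {v})"
    using T(3) by (rule M.nonsepD)
  ultimately show False
    using uw reachable_if_conn by metis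
qed

text \<open>For every \<open>T\<close> that includes \<open>verts B\<close> and has no separating
  vertex, \<open>G \<restriction> T\<close> competes in the maximality of \<open>B\<close> and so
  equals \<open>B\<close>. Taking \<open>T = verts B\<close> shows that \<open>B\<close> is induced;
  arbitrary \<open>T\<close> shows that \<open>verts B\<close> is maximal.\<close>

lemma blockD:
  assumes B: "block G B"
  shows "M.block_set (verts B)" "B = G \<restriction> verts B"
proof -
  have sub: "subgraph B G" and B_graph: "graph B" and B_conn: "Digraph_Component.connected B"
    and no_cut: "\<nexists>v. cut_vertex B v"
    and maximal: "\<And>H. \<lbrakk>subgraph B H; subgraph H G; graph H; Digraph_Component.connected H;
      \<nexists>v. cut_vertex H v\<rbrakk> \<Longrightarrow> H = B"
    using B unfolding block_def max_subgraph_def by blast+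
  interpret B: graph B by (rule B_graph)
  have ne: "verts B \<noteq> {}"
    using B_conn unfolding connected_def strongly_connected_def by simp
  have reach: "u \<rightarrow>\<^sup>*\<^bsub>B\<^esub> v" if "u \<in> verts B" "v \<in> verts B" for u v
    using B.connected_reachable B_conn that by blast
  have arcs_B: "u \<rightarrow>\<^bsub>B\<^esub> v \<Longrightarrow> u \<rightarrow> v" for u v
    using arcs_ends_mono[OF sub] by blast
  have conn_B: "M.conn (verts B)"
    using reach arcs_B unfolding reachable_def by (rule conn_if_reachable)
  have "M.conn (verts B - {w})" for w
  proof (cases "w \<in> verts B")
    case True
    show ?thesis
    proof (rule conn_if_reachable)
      fix u v assume uv: "u \<in> verts B - {w}" "v \<in> verts B - {w}"
      then have "u \<rightarrow>\<^sup>*\<^bsub>pre_digraph.del_vert B w\<^esub> v"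
        using no_cut True reach unfolding cut_vertex_def by blast
      then show "(u, v) \<in> rtrancl_on (verts B - {w}) (arcs_ends (pre_digraph.del_vert B w))"
        unfolding reachable_def by (simp add: B.verts_del_vert)
    next
      fix u v assume "u \<rightarrow>\<^bsub>pre_digraph.del_vert B w\<^esub> v"
      then show "u \<rightarrow> v"
        by (intro arcs_B) (auto simp: arcs_ends_conv pre_digraph.del_vert_def)
    qed
  qed (use conn_B in simp)
  with conn_B have nonsep: "M.nonsep (verts B)"
    unfolding M.nonsep_def by blast
  have B_sub: "verts B \<subseteq> verts G"
    using sub by blast
  have restr: "G \<restriction> T = B" if T: "verts B \<subseteq> T" "T \<subseteq> verts G" "M.nonsep T" for T
  proof (rule maximal)
    show "subgraph (G \<restriction> T) G"
      using T(2) by (rule subgraph_induce_subgraphI)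
    have "compatible (G \<restriction> T) B"
      using sub unfolding subgraph_def compatible_def by simp
    moreover have "tail G = tail B" "head G = head B" "arcs B \<subseteq> arcs G"
      using sub unfolding subgraph_def compatible_def by auto
    ultimately show "subgraph B (G \<restriction> T)"
      using T(1) B.wf_digraph wellformed_induce_subgraph
      by (intro subgraphI) (auto dest: B.wellformed)
    show "graph (G \<restriction> T)" "Digraph_Component.connected (G \<restriction> T)" "\<nexists>v. cut_vertex (G \<restriction> T) v"
      using induced_block[OF T(2) _ T(3)] ne T(1) by blast+
  qed
  show "B = G \<restriction> verts B"
    using restr[OF subset_refl B_sub nonsep] by (rule sym)
  have "T = verts B" if "verts B \<subseteq> T" "T \<subseteq> verts G" "M.nonsep T" for T
    using restr[OF that] induce_subgraph_verts by metis
  then show "M.block_set (verts B)"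
    unfolding M.block_set_def using ne B_sub nonsep by blast
qed

lemma block_adj:
  assumes "block G B"
  shows "u \<rightarrow>\<^bsub>B\<^esub> v \<longleftrightarrow> u \<in> verts B \<and> v \<in> verts B \<and> u \<rightarrow> v"
proof -
  have "arcs_ends B = arcs_ends (G \<restriction> verts B)"
    by (rule arg_cong[OF blockD(2)[OF assms]])
  then show ?thesis
    by (auto simp: arcs_ends_conv image_iff)
qed

lemma triangle_free_block_set:
  assumes "block G B" "triangle_free B"
  shows "M.triangle_free_set (verts B)"
  using assms(2) unfolding triangle_free_def M.triangle_free_set_def block_adj[OF assms(1)] by blast

end

section \<open>The cycle of length five\<close>

lemma parcs_cycle_graph_5: "parcs (cycle_graph 5) =
    {(0, 1), (1, 0), (1, 2), (2, 1), (2, 3), (3, 2), (3, 4), (4, 3), (4, 0), (0, 4)}" (is "?L = ?R")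
proof
  have succ: "(i, Suc i mod 5) \<in> ?R" "(Suc i mod 5, i) \<in> ?R" if "i < 5" for i :: nat
  proof -
    have "i \<in> {0, 1, 2, 3, 4}"
      using that by auto
    then show "(i, Suc i mod 5) \<in> ?R" "(Suc i mod 5, i) \<in> ?R"
      by (elim insertE emptyE; simp)+
  qed
  show "?L \<subseteq> ?R"
  proof (rule subrelI)
    fix i j assume "(i, j) \<in> ?L"
    then have ij: "i < 5" "j < 5" "j = Suc i mod 5 \<or> i = Suc j mod 5"
      by (simp_all add: cycle_graph_def)
    from ij(3) show "(i, j) \<in> ?R"
      using succ(1)[OF ij(1)] succ(2)[OF ij(2)] by (elim disjE ssubst)
  qed
  show "?R \<subseteq> ?L"
    by (simp add: cycle_graph_def)
qed

lemma cycle_graph_5_iso: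
  assumes "digraph_iso B (cycle_graph 5)"
  shows "card (verts B) = 5" "triangle_free B"
proof -
  obtain f where f: "pre_digraph.digraph_isomorphism B f" "with_proj (cycle_graph 5) = app_iso f B"
    using assms unfolding digraph_iso_def by blast
  have "iso_verts f ` verts B = {..<5}"
    using arg_cong[OF f(2), of verts] by (simp add: cycle_graph_def)
  then show "card (verts B) = 5"
    using pre_digraph.digraph_isomorphism_inj_on_verts[OF f(1)] card_image by fastforce
  have "(iso_verts f u, iso_verts f v) \<in> parcs (cycle_graph 5)" if "u \<rightarrow>\<^bsub>B\<^esub> v" for u v
  proof -
    have "arcs_ends (with_proj (cycle_graph 5)) = (\<lambda>(u, v). (iso_verts f u, iso_verts f v)) ` arcs_ends B"
      unfolding f(2) using f(1) unfolding pre_digraph.digraph_isomorphism_def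
      by (intro wf_digraph.arcs_ends_app_iso_eq) (auto simp: pre_digraph.digraph_isomorphism_def)
    then show ?thesis using that by force
  qed
  moreover have "\<not> ((i, j) \<in> parcs (cycle_graph 5) \<and> (j, k) \<in> parcs (cycle_graph 5) \<and>
      (k, i) \<in> parcs (cycle_graph 5))" for i j k
  proof
    \<comment> \<open>Labels of adjacent vertices differ by 1 or are 0 and 4; no three labels
      satisfy this pairwise.\<close>
    have step: "i = Suc j \<or> j = Suc i \<or> i = 0 \<and> j = 4 \<or> i = 4 \<and> j = 0"
      if "(i, j) \<in> parcs (cycle_graph 5)" for i j
      using that unfolding parcs_cycle_graph_5 by (elim insertE emptyE) simp_all
    assume "(i, j) \<in> parcs (cycle_graph 5) \<and> (j, k) \<in> parcs (cycle_graph 5) \<and>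
      (k, i) \<in> parcs (cycle_graph 5)"
    then show False
      using step[of i j] step[of j k] step[of k i] by linarith
  qed
  ultimately show "triangle_free B"
    unfolding triangle_free_def by blast
qed

lemma (in digraph) digraph_iso_if_bij:
  fixes H :: "'c pair_pre_digraph"
  assumes f: "bij_betw f (verts G) (pverts H)"
    and adj: "(\<lambda>(u, v). (f u, f v)) ` arcs_ends G = parcs H"
  shows "digraph_iso G H"
  unfolding digraph_iso_def
proof (intro exI conjI)
  let ?h = "\<lparr>iso_verts = f, iso_arcs = \<lambda>e. (f (tail G e), f (head G e)), iso_head = snd, iso_tail = fst\<rparr>"
  have inj: "inj_on f (verts G)"
    using f bij_betw_imp_inj_on by blast
  have "inj_on (\<lambda>e. (f (tail G e), f (head G e))) (arcs G)"
    using inj_on_eq_iff[OF inj] no_multi_arcs by (intro inj_onI) (simp add: arc_to_ends_def)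
  then show "digraph_isomorphism ?h"
    unfolding digraph_isomorphism_def using inj wf_digraph by simp
  have "(\<lambda>e. (f (tail G e), f (head G e))) ` arcs G = parcs H"
    unfolding adj[symmetric] arcs_ends_conv by (simp add: image_image)
  moreover have "f ` verts G = pverts H"
    using f unfolding bij_betw_def by simp
  ultimately show "with_proj H = app_iso ?h G"
    unfolding app_iso_def with_proj_def by simp
qed

lemma (in connected_graph) pentagon_iso:
  assumes B: "block G B" and tf: "triangle_free B" and pent: "M.pentagon (verts B)"
  shows "digraph_iso B (cycle_graph 5)"
proof -
  interpret B: graph B
    using B unfolding block_def max_subgraph_def by (elim conjE)
  obtain v0 v1 v2 v3 v4 where verts_B: "verts B = {v0, v1, v2, v3, v4}"
    and dist: "distinct [v0, v1, v2, v3, v4]"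
    and "v0 \<rightarrow> v1" "v1 \<rightarrow> v2" "v2 \<rightarrow> v3" "v3 \<rightarrow> v4" "v4 \<rightarrow> v0"
    using pent unfolding M.pentagon_def by blast
  then have cyc: "v0 \<rightarrow>\<^bsub>B\<^esub> v1" "v1 \<rightarrow>\<^bsub>B\<^esub> v2" "v2 \<rightarrow>\<^bsub>B\<^esub> v3" "v3 \<rightarrow>\<^bsub>B\<^esub> v4" "v4 \<rightarrow>\<^bsub>B\<^esub> v0"
    by (simp_all add: block_adj[OF B])
  \<comment> \<open>Any two nonconsecutive vertices of the five have a common neighbour, so an edge
    between them would close a triangle.\<close>
  have chord: "\<not> a \<rightarrow>\<^bsub>B\<^esub> c" "\<not> c \<rightarrow>\<^bsub>B\<^esub> a" if "a \<rightarrow>\<^bsub>B\<^esub> b" "b \<rightarrow>\<^bsub>B\<^esub> c" for a b c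
    using that tf B.graph_symmetric unfolding triangle_free_def by blast+
  let ?E = "{(v0, v1), (v1, v0), (v1, v2), (v2, v1), (v2, v3), (v3, v2), (v3, v4), (v4, v3), (v4, v0), (v0, v4)}"
  have ends_B: "arcs_ends B = ?E"
  proof
    show "?E \<subseteq> arcs_ends B"
      using cyc B.graph_symmetric by simp
    show "arcs_ends B \<subseteq> ?E"
    proof (intro subrelI, rule ccontr)
      fix a b assume ab: "a \<rightarrow>\<^bsub>B\<^esub> b" "(a, b) \<notin> ?E"
      then have "a \<in> {v0, v1, v2, v3, v4}" "b \<in> {v0, v1, v2, v3, v4}" "a \<noteq> b"
        using B.adj_in_verts[OF ab(1)] B.adj_not_same verts_B by auto
      then show False
        using ab chord[OF cyc(1,2)] chord[OF cyc(2,3)] chord[OF cyc(3,4)] chord[OF cyc(4,5)]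
          chord[OF cyc(5,1)] by auto
    qed
  qed
  define f where "f = (\<lambda>v. if v = v0 then 0 else if v = v1 then 1 else if v = v2 then 2
    else if v = v3 then 3 else (4 :: nat))"
  have f: "f v0 = 0" "f v1 = 1" "f v2 = 2" "f v3 = 3" "f v4 = 4"
    using dist unfolding f_def by auto
  show ?thesis
  proof (rule B.digraph_iso_if_bij)
    have "f ` verts B = {..<5}"
      unfolding verts_B by (auto simp: f)
    moreover have "inj_on f (verts B)"
      unfolding verts_B by (auto simp: inj_on_def f)
    ultimately show "bij_betw f (verts B) (pverts (cycle_graph 5))"
      unfolding bij_betw_def by (simp add: cycle_graph_def)
    show "(\<lambda>(u, v). (f u, f v)) ` arcs_ends B = parcs (cycle_graph 5)"
      unfolding ends_B parcs_cycle_graph_5 by (simp add: f)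
  qed
qed

theorem theorem16:
  fixes G :: "('a, 'b) pre_digraph" and n :: nat
  assumes "graph G"
    and "Digraph_Component.connected G"
    and "card (verts G) = n"
    and "(\<exists>B. block G B \<and> two_connected B \<and> triangle_free B \<and> \<not> digraph_iso B (cycle_graph 5))
      \<or> (\<exists>B\<^sub>1 B\<^sub>2. block G B\<^sub>1 \<and> block G B\<^sub>2 \<and> B\<^sub>1 \<noteq> B\<^sub>2 \<and>
            digraph_iso B\<^sub>1 (cycle_graph 5) \<and> digraph_iso B\<^sub>2 (cycle_graph 5))"
  shows "eta G \<ge> 2 * int n"
proof -
  interpret graph G by (rule assms(1))
  interpret connected_graph G by unfold_locales (rule assms(2))
  from assms(4) have "4 * card (verts G) \<le> (\<Sum>x\<in>verts G. \<Sum>u\<in>verts G. M.excess x u)"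
  proof (elim disjE exE conjE)
    fix B assume B: "block G B" "two_connected B" "triangle_free B" "\<not> digraph_iso B (cycle_graph 5)"
    show ?thesis
    proof (rule M.sum_excess_ge_if_not_pentagon)
      show "3 \<le> card (verts B)"
        using B(2) unfolding two_connected_def by blast
      show "\<not> M.pentagon (verts B)"
        using pentagon_iso B by blast
    qed (use B blockD triangle_free_block_set in blast)+
  next
    fix B1 B2 assume B: "block G B1" "block G B2" "B1 \<noteq> B2"
      and iso: "digraph_iso B1 (cycle_graph 5)" "digraph_iso B2 (cycle_graph 5)"
    note iso1 = cycle_graph_5_iso[OF iso(1)] and iso2 = cycle_graph_5_iso[OF iso(2)]
    \<comment> \<open>Blocks are induced subgraphs, so distinct blocks have distinct vertex
      sets.\<close>
    have "verts B1 \<noteq> verts B2"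
      using B blockD(2) by metis
    then show ?thesis
      using iso1(1) iso2(1) B iso1(2) iso2(2) blockD(1) triangle_free_block_set
      by (intro M.sum_excess_ge_two_blocks[of "verts B1" "verts B2"]) simp_all
  qed
  then have "int (4 * card (verts G)) \<le> 2 * eta G"
    unfolding eta_double by (rule of_nat_mono)
  then show ?thesis
    using assms(3) by simp
qed

end
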